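(* Given a determinantal point process defined by a positive semidefinite matrix $L\in\mathbb{R}^{m\times m}$ and a partition family $\mathcal{C}\subseteq2^{[m]}$ with a constant number $p$ of parts, there exists a sampling algorithm, running in polynomial time (for each fixed $p$, polynomial in $m$), for the distribution $$\mu_{\mathcal{C}}(S)=\frac{\det(L_{S,S})}{\sum_{T\in\mathcal{C}}\det(L_{T,T})}\qquad\text{for } S\in\mathcal{C}.$$
   Context: $[m]=\{1,\dots,m\}$. A partition family is a family of the form $\mathcal{C}=\{S\subseteq[m]:|S\cap P_j|=b_j\text{ for every }j=1,\dots,p\}$, where $[m]=P_1\cup\dots\cup P_p$ is a partition into disjoint nonempty sets and $b_1,\dots,b_p$ are integers with $0\le b_j\le|P_j|$. $L_{S,S}$ is the principal submatrix of $L$ with rows and columns in $S$, and $\det(L_{\emptyset,\emptyset})=1$. Running time counts exact real arithmetic operations, and tosses of a coin with a computed bias in $[0,1]$, at unit cost. The sampling problem is considered only when $\sum_{T\in\mathcal{C}}\det(L_{T,T})>0$. *)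

theory Defs
  imports
    "HOL-Probability.Probability_Mass_Function"
    "HOL-Computational_Algebra.Polynomial"
    "Jordan_Normal_Form.Determinant"
    "Jordan_Normal_Form.DL_Submatrix"
begin

section \<open>Determinantal point processes restricted to partition families\<close>

text \<open>The ground set $[m]$ is rendered as \<open>{0..<m}\<close>, and the part indices as \<open>{0..<p}\<close>, in accordance
  with the indexing of matrices.\<close>

definition psd :: "nat \<Rightarrow> real mat \<Rightarrow> bool" where
  "psd m L \<longleftrightarrow> L \<in> carrier_mat m m \<and> transpose_mat L = L \<and>
     (\<forall>v \<in> carrier_vec m. 0 \<le> scalar_prod v (mult_mat_vec L v))"

text \<open>The principal minor $\det(L_{S,S})$. For \<open>S = {}\<close> the submatrix is the $0 \times 0$ matrix,
  whose library determinant is \<open>1\<close>.\<close>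

definition pminor :: "real mat \<Rightarrow> nat set \<Rightarrow> real" where
  "pminor L S = Determinant.det (submatrix L S S)"

definition partition_data :: "nat \<Rightarrow> nat \<Rightarrow> (nat \<Rightarrow> nat set) \<Rightarrow> (nat \<Rightarrow> nat) \<Rightarrow> bool" where
  "partition_data m p P b \<longleftrightarrow>
     (\<Union>j<p. P j) = {0..<m} \<and> disjoint_family_on P {..<p} \<and> (\<forall>j<p. P j \<noteq> {}) \<and>
     (\<forall>j<p. b j \<le> card (P j))"

definition partition_family :: "nat \<Rightarrow> nat \<Rightarrow> (nat \<Rightarrow> nat set) \<Rightarrow> (nat \<Rightarrow> nat) \<Rightarrow> nat set set" where
  "partition_family m p P b = {S. S \<subseteq> {0..<m} \<and> (\<forall>j<p. card (S \<inter> P j) = b j)}"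

definition dpp_mass :: "real mat \<Rightarrow> nat set set \<Rightarrow> real" where
  "dpp_mass L C = (\<Sum>T\<in>C. pminor L T)"

definition dpp_restricted :: "real mat \<Rightarrow> nat set set \<Rightarrow> nat set \<Rightarrow> real" where
  "dpp_restricted L C S = pminor L S / dpp_mass L C"


section \<open>A randomized real RAM\<close>

text \<open>
  Programs are finite while-programs over a memory with two kinds of cells: cells holding natural
  numbers, used for indices and control, and cells holding real numbers. A cell is addressed by an
  array name and a list of computed indices (the empty list for a scalar variable). On reals there
  are exact \<open>+\<close>, \<open>-\<close>, \<open>*\<close>, \<open>/\<close> and comparison, and a coin may be tossed with a computed bias.

  Three restrictions keep the unit-cost charge honest: a program contains no real literals;
  a real cannot be rounded to an index; and indices can only be added and subtracted.
  Division by zero yields \<open>0\<close>, which a program could arrange by a comparison anyway.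
\<close>

type_synonym name = string

record state =
  nats :: "name \<Rightarrow> nat list \<Rightarrow> nat"
  reals :: "name \<Rightarrow> nat list \<Rightarrow> real"

datatype nexp =
    NLit nat
  | NGet name "nexp list"
  | NAdd nexp nexp
  | NSub nexp nexp

datatype rexp =
    ROfNat nexp
  | RGet name "nexp list"
  | RAdd rexp rexp
  | RSub rexp rexp
  | RMul rexp rexp
  | RDiv rexp rexp

datatype test =
    NLess nexp nexp
  | RLess rexp rexp
  | Neg test
  | Conj test test

datatype com =
    Skip
  | SetN name "nexp list" nexp
  | SetR name "nexp list" rexp
  | Toss name "nexp list" rexp
  | Seq com com
  | Cond test com com
  | While test com

fun nval :: "state \<Rightarrow> nexp \<Rightarrow> nat" where
  "nval s (NLit k) = k"
| "nval s (NGet x is) = nats s x (map (nval s) is)"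
| "nval s (NAdd a b) = nval s a + nval s b"
| "nval s (NSub a b) = nval s a - nval s b"

fun rval :: "state \<Rightarrow> rexp \<Rightarrow> real" where
  "rval s (ROfNat a) = real (nval s a)"
| "rval s (RGet x is) = reals s x (map (nval s) is)"
| "rval s (RAdd a b) = rval s a + rval s b"
| "rval s (RSub a b) = rval s a - rval s b"
| "rval s (RMul a b) = rval s a * rval s b"
| "rval s (RDiv a b) = rval s a / rval s b"

fun tval :: "state \<Rightarrow> test \<Rightarrow> bool" where
  "tval s (NLess a b) \<longleftrightarrow> nval s a < nval s b"
| "tval s (RLess a b) \<longleftrightarrow> rval s a < rval s b"
| "tval s (Neg c) \<longleftrightarrow> \<not> tval s c"
| "tval s (Conj c d) \<longleftrightarrow> tval s c \<and> tval s d"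

text \<open>Every operation is charged one unit, including memory accesses, index arithmetic, and tests;
  bounding this cost bounds in particular the number of real operations and coin tosses.\<close>

fun ncost :: "nexp \<Rightarrow> nat" where
  "ncost (NLit k) = 1"
| "ncost (NGet x is) = 1 + sum_list (map ncost is)"
| "ncost (NAdd a b) = 1 + ncost a + ncost b"
| "ncost (NSub a b) = 1 + ncost a + ncost b"

fun rcost :: "rexp \<Rightarrow> nat" where
  "rcost (ROfNat a) = 1 + ncost a"
| "rcost (RGet x is) = 1 + sum_list (map ncost is)"
| "rcost (RAdd a b) = 1 + rcost a + rcost b"
| "rcost (RSub a b) = 1 + rcost a + rcost b"
| "rcost (RMul a b) = 1 + rcost a + rcost b"
| "rcost (RDiv a b) = 1 + rcost a + rcost b"

fun tcost :: "test \<Rightarrow> nat" where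
  "tcost (NLess a b) = 1 + ncost a + ncost b"
| "tcost (RLess a b) = 1 + rcost a + rcost b"
| "tcost (Neg c) = 1 + tcost c"
| "tcost (Conj c d) = 1 + tcost c + tcost d"

definition put_nat :: "name \<Rightarrow> nat list \<Rightarrow> nat \<Rightarrow> state \<Rightarrow> state" where
  "put_nat x is k s = s\<lparr>nats := (nats s)(x := (nats s x)(is := k))\<rparr>"

definition put_real :: "name \<Rightarrow> nat list \<Rightarrow> real \<Rightarrow> state \<Rightarrow> state" where
  "put_real x is r s = s\<lparr>reals := (reals s)(x := (reals s x)(is := r))\<rparr>"

definition charge :: "nat \<Rightarrow> (state \<times> nat) pmf \<Rightarrow> (state \<times> nat) pmf" where
  "charge k M = map_pmf (\<lambda>(s, t). (s, k + t)) M"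

definition followed_by :: "(state \<times> nat) pmf \<Rightarrow> (state \<Rightarrow> (state \<times> nat) pmf) \<Rightarrow> (state \<times> nat) pmf" where
  "followed_by M K = bind_pmf M (\<lambda>(s, t). charge t (K s))"

text \<open>\<open>exec c s M\<close>: every run of \<open>c\<close> from \<open>s\<close> terminates without error, and \<open>M\<close> is the joint
  distribution of the final state and the running time. There is no derivation if some run diverges
  or tosses a coin whose bias lies outside $[0,1]$. In the rules for sequencing and loops, only the
  values of \<open>K\<close> on the support of \<open>M\<close> matter.\<close>

inductive exec :: "com \<Rightarrow> state \<Rightarrow> (state \<times> nat) pmf \<Rightarrow> bool" where
  Skip: "exec Skip s (return_pmf (s, 1))"
| SetN: "exec (SetN x is a) s
    (return_pmf (put_nat x (map (nval s) is) (nval s a) s, 1 + sum_list (map ncost is) + ncost a))"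
| SetR: "exec (SetR x is e) s
    (return_pmf (put_real x (map (nval s) is) (rval s e) s, 1 + sum_list (map ncost is) + rcost e))"
| Toss: "0 \<le> rval s e \<Longrightarrow> rval s e \<le> 1 \<Longrightarrow>
    exec (Toss x is e) s
      (map_pmf (\<lambda>h. (put_nat x (map (nval s) is) (if h then 1 else 0) s,
                      1 + sum_list (map ncost is) + rcost e))
        (bernoulli_pmf (rval s e)))"
| Seq: "exec c s M \<Longrightarrow> (\<And>s' t. (s', t) \<in> set_pmf M \<Longrightarrow> exec d s' (K s')) \<Longrightarrow>
    exec (Seq c d) s (followed_by M K)"
| CondTrue: "tval s g \<Longrightarrow> exec c s M \<Longrightarrow> exec (Cond g c d) s (charge (1 + tcost g) M)"
| CondFalse: "\<not> tval s g \<Longrightarrow> exec d s M \<Longrightarrow> exec (Cond g c d) s (charge (1 + tcost g) M)"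
| WhileFalse: "\<not> tval s g \<Longrightarrow> exec (While g c) s (return_pmf (s, 1 + tcost g))"
| WhileTrue: "tval s g \<Longrightarrow> exec c s M \<Longrightarrow>
    (\<And>s' t. (s', t) \<in> set_pmf M \<Longrightarrow> exec (While g c) s' (K s')) \<Longrightarrow>
    exec (While g c) s (charge (1 + tcost g) (followed_by M K))"

lemma followed_by_cong:
  assumes "\<And>s t. (s, t) \<in> set_pmf M \<Longrightarrow> K s = K' s"
  shows "followed_by M K = followed_by M K'"
  unfolding followed_by_def by (rule bind_pmf_cong) (use assms in auto)

theorem exec_deterministic: "exec c s M \<Longrightarrow> exec c s M' \<Longrightarrow> M = M'"
proof (induction arbitrary: M' rule: exec.induct)
  case (Seq c s M d K)
  from Seq.prems show ?case
  proof cases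
    case (Seq N K')
    then have "N = M" using Seq.IH(1) by simp
    then show ?thesis using Seq Seq.IH(2) by (auto intro!: followed_by_cong)
  qed
next
  case (WhileTrue s g c M K)
  from WhileTrue.prems show ?case
  proof cases
    case WhileFalse
    then show ?thesis using WhileTrue.hyps by simp
  next
    case (WhileTrue N K')
    then have "N = M" using WhileTrue.IH(1) by simp
    then show ?thesis using WhileTrue WhileTrue.IH(2)
      by (auto intro!: followed_by_cong arg_cong[where f = "charge _"])
  qed
qed (erule exec.cases; auto)+


section \<open>Input, output, and sampling in polynomial time\<close>

text \<open>The input consists of the numbers \<open>m\<close> and \<open>p\<close>, the incidence table of the parts, the
  prescribed cardinalities, and the entries of the matrix. All other cells are zero.\<close>

definition input :: "nat \<Rightarrow> real mat \<Rightarrow> nat \<Rightarrow> (nat \<Rightarrow> nat set) \<Rightarrow> (nat \<Rightarrow> nat) \<Rightarrow> state" where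
  "input m L p P b =
    \<lparr>nats = (\<lambda>x is.
        if x = ''m'' \<and> is = [] then m
        else if x = ''p'' \<and> is = [] then p
        else case is of
            [j] \<Rightarrow> if x = ''b'' \<and> j < p then b j else 0
          | [j, i] \<Rightarrow> if x = ''P'' \<and> j < p \<and> i \<in> P j then 1 else 0
          | _ \<Rightarrow> 0),
     reals = (\<lambda>x is. case is of
            [i, j] \<Rightarrow> if x = ''L'' \<and> i < m \<and> j < m then L $$ (i, j) else 0
          | _ \<Rightarrow> 0)\<rparr>"

definition selected :: "nat \<Rightarrow> state \<Rightarrow> nat set" where
  "selected m s = {i \<in> {0..<m}. nats s ''S'' [i] \<noteq> 0}"

definition samples_within ::
  "com \<Rightarrow> state \<Rightarrow> (state \<Rightarrow> nat set) \<Rightarrow> nat set set \<Rightarrow> (nat set \<Rightarrow> real) \<Rightarrow> nat \<Rightarrow> bool" where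
  "samples_within prog s out C \<mu> T \<longleftrightarrow>
     (\<exists>M. exec prog s M \<and>
          (\<forall>(s', t) \<in> set_pmf M. out s' \<in> C \<and> t \<le> T) \<and>
          (\<forall>S \<in> C. pmf (map_pmf (\<lambda>(s', t). out s') M) S = \<mu> S))"

end

theory Submission
  imports Defs "Jordan_Normal_Form.Char_Poly"
begin

text \<open>
  The elements of $[m]$ are decided one after the other. If $A$ is the set of elements selected among
  the first $i$, the next coin has bias $Z_{i+1}(A \cup \{i\}) / Z_i(A)$, where $Z_i(A)$ is the sum of
  $\det(L_{S,S})$ over all $S \in \mathcal{C}$ with $S \cap [i] = A$.

  Each $Z_i(A)$ is one coefficient of a univariate generating polynomial: give element $s$ a weight
  $\varepsilon_s \ge 1$, so that $\det(I + L \, \mathrm{diag}(z^{\varepsilon_s})) =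
  \sum_S \det(L_{S,S}) z^{\varepsilon(S)}$. Writing the $p$ cardinality constraints and the
  constraint $S \cap [i] = A$ as digits in base $m + 1$, the weights can be chosen such that the sets
  relevant for $Z_i(A)$ are exactly those of one total weight $K < (m+1)^{p+1}$.

  The coefficients $G_e$ of the determinant and $B_e$ of the adjugate satisfy a Faddeev-LeVerrier
  recursion: $B_e = G_e I - T_e$, where $T_e[r,c] = \sum_s L_{rs} B_{e - \varepsilon_s}[s,c]$ involves
  only earlier coefficients, and $e \, G_e = \sum_s \varepsilon_s T_e[s,s]$. No pivoting, no division
  by data and no interpolation is needed.
\<close>

section \<open>Principal minors\<close>

text \<open>Two obstacles shape the construction. The sum \<open>Z_i(A)\<close> has exponentially
  many terms, and a generating polynomial that separates them would naturally need one variable per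
  part and one more for the condition. Digits in base \<open>m + 1\<close> merge these variables
  into one without carries, because every count is at most \<open>m\<close>. The price is an
  exponent range of \<open>(m+1)^(p+1)\<close>, polynomial in \<open>m\<close> because
  \<open>p\<close> is fixed. The second obstacle is circularity: \<open>B_e\<close> is expressed
  through \<open>G_e\<close>. It is broken because \<open>T_e[s,s] = G_e - B_e[s,s]\<close> is the
  sum of the minors of weight \<open>e\<close> whose index set contains \<open>s\<close>. Weighted
  by \<open>\<epsilon>_s\<close> and summed over \<open>s\<close>, every set of weight
  \<open>e\<close> is counted \<open>e\<close> times, so for \<open>e > 0\<close> the trace of
  \<open>T_e\<close> alone yields \<open>G_e\<close>. Positive semidefiniteness enters through the
  nonnegativity of principal minors. It puts each bias in [0,1], and it makes all minors in a class
  of total mass zero vanish, so the branches that the coin never takes carry no part of the target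
  law.\<close>

definition perm_det :: "(nat \<Rightarrow> nat \<Rightarrow> 'a::comm_ring_1) \<Rightarrow> nat set \<Rightarrow> 'a" where
  "perm_det a S = (\<Sum>\<pi> | \<pi> permutes S. of_int (sign \<pi>) * (\<Prod>i\<in>S. a i (\<pi> i)))"

lemma det_eq_perm_det:
  "Determinant.det (mat n n (\<lambda>(i, j). a i j)) = perm_det a {0..<n}"
  unfolding perm_det_def
  by (subst det_def'[of _ n])
    (auto intro!: sum.cong prod.cong simp: permutes_in_image[where S = "{0..<n}", simplified])

text \<open>Conjugation by \<open>f\<close> matches the permutations of \<open>A\<close> with those
  of \<open>B\<close> and keeps the sign. This removes the renumbering of rows that
  \<open>submatrix\<close> performs, so that minors of different sets can be compared inside one
  Leibniz expansion.\<close>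

lemma perm_det_reindex:
  assumes f: "bij_betw f A B" and fin: "finite A"
  shows "perm_det (\<lambda>i j. a (f i) (f j)) A = perm_det a B"
proof -
  have inj: "inj_on f A" and img: "f ` A = B"
    using f by (auto simp: bij_betw_def)
  \<comment> \<open>The explicit conjugation formula gives the bijection between the permutation
    sets; \<open>map_permutation\<close> carries the rule for signs.\<close>
  have "map_permutation A f = (\<lambda>\<pi> x. if x \<in> B then f (\<pi> (inv_into A f x)) else x)"
    by (auto simp: fun_eq_iff map_permutation_def restrict_id_def img)
  then have bij: "bij_betw (map_permutation A f) {\<pi>. \<pi> permutes A} {\<pi>. \<pi> permutes B}"
    using bij_betw_permutations[OF f] by simp
  show ?thesis
    unfolding perm_det_def
  proof (subst sum.reindex_bij_betw[OF bij, symmetric], intro sum.cong refl)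
    fix \<pi> assume "\<pi> \<in> {\<pi>. \<pi> permutes A}"
    then have \<pi>: "\<pi> permutes A" by simp
    have "(\<Prod>i\<in>B. a i (map_permutation A f \<pi> i)) = (\<Prod>i\<in>A. a (f i) (map_permutation A f \<pi> (f i)))"
      by (rule prod.reindex_bij_betw[OF f, symmetric])
    also have "\<dots> = (\<Prod>i\<in>A. a (f i) (f (\<pi> i)))"
      by (simp add: map_permutation_apply[OF inj])
    finally show "of_int (sign \<pi>) * (\<Prod>i\<in>A. a (f i) (f (\<pi> i))) =
        of_int (sign (map_permutation A f \<pi>)) * (\<Prod>i\<in>B. a i (map_permutation A f \<pi> i))"
      by (simp add: sign_map_permutation[OF inj \<pi> fin])
  qed
qed

lemma bij_betw_pick:
  assumes "finite S"
  shows "bij_betw (pick S) {0..<card S} S"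
proof -
  have "inj_on (pick S) {0..<card S}"
    by (rule linorder_inj_onI) (auto dest: pick_mono_le[rotated])
  moreover have "pick S ` {0..<card S} \<subseteq> S"
    by (auto intro: pick_in_set_le)
  ultimately show ?thesis
    using card_subset_eq[OF assms, of "pick S ` {0..<card S}"] by (simp add: bij_betw_def card_image)
qed

lemma submatrix_eq_mat:
  assumes "L \<in> carrier_mat m m" "S \<subseteq> {0..<m}"
  shows "submatrix L S S = mat (card S) (card S) (\<lambda>(i, j). L $$ (pick S i, pick S j))"
proof -
  have "{i. i < m \<and> i \<in> S} = S" using assms by auto
  then show ?thesis using assms by (auto simp: submatrix_def)
qed

lemma pminor_eq_perm_det:
  assumes "L \<in> carrier_mat m m" "S \<subseteq> {0..<m}"
  shows "pminor L S = perm_det (\<lambda>i j. L $$ (i, j)) S"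
proof -
  have "finite S" using assms(2) finite_subset by blast
  then show ?thesis
    by (simp add: pminor_def submatrix_eq_mat[OF assms] det_eq_perm_det
        perm_det_reindex[OF bij_betw_pick, where a = "\<lambda>i j. L $$ (i, j)"])
qed

text \<open>Applied to the embedding of constants into polynomials: minors of the real matrix become
  constant factors in the polynomial determinant.\<close>

lemma perm_det_hom:
  assumes "\<And>x y. h (x + y) = h x + h y" "\<And>x y. h (x * y) = h x * h y" "h 0 = 0" "h 1 = 1"
    "\<And>x. h (- x) = - h x"
  shows "perm_det (\<lambda>i j. h (a i j)) S = h (perm_det a S)"
proof -
  have hs: "h (sum f A) = (\<Sum>x\<in>A. h (f x))" for f :: "(nat \<Rightarrow> nat) \<Rightarrow> 'a" and A
    using assms by (induction A rule: infinite_finite_induct) auto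
  have hp: "h (prod f A) = (\<Prod>x\<in>A. h (f x))" for f :: "nat \<Rightarrow> 'a" and A
    using assms by (induction A rule: infinite_finite_induct) auto
  have "h (of_int (sign \<pi>)) = of_int (sign \<pi>)" for \<pi> :: "nat \<Rightarrow> nat"
    using assms by (auto simp: sign_def)
  then show ?thesis
    by (simp add: perm_det_def hs hp assms(2))
qed

text \<open>Expanding the product in the Leibniz formula, a permutation contributes to the summand of \<open>S\<close>
  only if it fixes the complement of \<open>S\<close>.\<close>

lemma perm_det_one_plus_diag:
  fixes a :: "nat \<Rightarrow> nat \<Rightarrow> 'a::comm_ring_1"
  assumes U: "finite U"
  shows "perm_det (\<lambda>i j. (if i = j then 1 else 0) + a i j * y j) U =
    (\<Sum>S\<in>Pow U. perm_det a S * (\<Prod>i\<in>S. y i))"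
proof -
  let ?d = "\<lambda>\<pi> i. (if i = \<pi> i then 1 else 0 :: 'a)"
  let ?P = "\<lambda>S. {\<pi>. \<pi> permutes S}"
  have "perm_det (\<lambda>i j. (if i = j then 1 else 0) + a i j * y j) U =
      (\<Sum>\<pi>\<in>?P U. of_int (sign \<pi>) * (\<Prod>i\<in>U. a i (\<pi> i) * y (\<pi> i) + ?d \<pi> i))"
    by (simp add: perm_det_def add.commute)
  also have "\<dots> = (\<Sum>\<pi>\<in>?P U. \<Sum>S\<in>Pow U.
      of_int (sign \<pi>) * ((\<Prod>i\<in>S. a i (\<pi> i) * y (\<pi> i)) * (\<Prod>i\<in>U - S. ?d \<pi> i)))"
    by (simp only: prod_add[OF U] sum_distrib_left)
  also have "\<dots> = (\<Sum>S\<in>Pow U. \<Sum>\<pi>\<in>?P U.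
      of_int (sign \<pi>) * ((\<Prod>i\<in>S. a i (\<pi> i) * y (\<pi> i)) * (\<Prod>i\<in>U - S. ?d \<pi> i)))"
    by (rule sum.swap)
  also have "\<dots> = (\<Sum>S\<in>Pow U. perm_det a S * (\<Prod>i\<in>S. y i))"
  proof (rule sum.cong[OF refl])
    fix S assume "S \<in> Pow U"
    then have SU: "S \<subseteq> U" by simp
    have fS: "finite S" using SU U finite_subset by blast
    have "(\<Sum>\<pi>\<in>?P U. of_int (sign \<pi>) * ((\<Prod>i\<in>S. a i (\<pi> i) * y (\<pi> i)) * (\<Prod>i\<in>U - S. ?d \<pi> i)))
        = (\<Sum>\<pi>\<in>?P S. of_int (sign \<pi>) * ((\<Prod>i\<in>S. a i (\<pi> i) * y (\<pi> i)) * (\<Prod>i\<in>U - S. ?d \<pi> i)))"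
    proof (rule sum.mono_neutral_right)
      show "finite (?P U)" by (rule finite_permutations[OF U])
      show "?P S \<subseteq> ?P U" using SU by (auto intro: permutes_subset)
      show "\<forall>\<pi>\<in>?P U - ?P S.
          of_int (sign \<pi>) * ((\<Prod>i\<in>S. a i (\<pi> i) * y (\<pi> i)) * (\<Prod>i\<in>U - S. ?d \<pi> i)) = 0"
      proof
        fix \<pi> assume \<pi>: "\<pi> \<in> ?P U - ?P S"
        then have "\<exists>i\<in>U - S. \<pi> i \<noteq> i"
          using permutes_superset[of \<pi> U S] by auto
        then obtain i where "i \<in> U - S" "\<pi> i \<noteq> i" by blast
        then have "(\<Prod>i\<in>U - S. ?d \<pi> i) = 0"
          using U by (intro prod_zero bexI[of _ i]) auto
        then show "of_int (sign \<pi>) * ((\<Prod>i\<in>S. a i (\<pi> i) * y (\<pi> i)) * (\<Prod>i\<in>U - S. ?d \<pi> i)) = 0"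
          by simp
      qed
    qed
    also have "\<dots> = (\<Sum>\<pi>\<in>?P S. of_int (sign \<pi>) * (\<Prod>i\<in>S. a i (\<pi> i)) * (\<Prod>i\<in>S. y i))"
    proof (rule sum.cong[OF refl])
      fix \<pi> assume "\<pi> \<in> ?P S"
      then have \<pi>: "\<pi> permutes S" by simp
      \<comment> \<open>The weights stand on columns; since \<open>\<pi>\<close> permutes
        \<open>S\<close>, their product can be read off the rows.\<close>
      have "(\<Prod>i\<in>S. y (\<pi> i)) = (\<Prod>i\<in>S. y i)"
        by (rule prod.reindex_bij_betw[OF permutes_imp_bij[OF \<pi>]])
      moreover have "(\<Prod>i\<in>U - S. ?d \<pi> i) = 1"
        using permutes_not_in[OF \<pi>] by (intro prod.neutral) auto
      ultimately show "of_int (sign \<pi>) * ((\<Prod>i\<in>S. a i (\<pi> i) * y (\<pi> i)) * (\<Prod>i\<in>U - S. ?d \<pi> i))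
          = of_int (sign \<pi>) * (\<Prod>i\<in>S. a i (\<pi> i)) * (\<Prod>i\<in>S. y i)"
        by (simp add: prod.distrib mult.assoc)
    qed
    also have "\<dots> = perm_det a S * (\<Prod>i\<in>S. y i)"
      by (simp add: perm_det_def sum_distrib_right)
    finally show "(\<Sum>\<pi>\<in>?P U.
        of_int (sign \<pi>) * ((\<Prod>i\<in>S. a i (\<pi> i) * y (\<pi> i)) * (\<Prod>i\<in>U - S. ?d \<pi> i)))
        = perm_det a S * (\<Prod>i\<in>S. y i)" .
  qed
  finally show ?thesis .
qed

text \<open>The characteristic polynomial of \<open>- A\<close> is monic and has no positive root, and its value at
  \<open>0\<close> is the determinant.\<close>

lemma det_nonneg:
  fixes A :: "real mat"
  assumes A: "A \<in> carrier_mat n n"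
    and psd: "\<And>v. v \<in> carrier_vec n \<Longrightarrow> 0 \<le> v \<bullet> (A *\<^sub>v v)"
  shows "0 \<le> Determinant.det A"
proof (rule ccontr)
  assume neg: "\<not> 0 \<le> Determinant.det A"
  let ?p = "char_poly (- A)"
  have A': "- A \<in> carrier_mat n n" using A by simp
  have "poly ?p 0 = Determinant.det A"
    unfolding char_poly_def
    by (rule poly_det_cong[of _ n]) (use A in \<open>auto simp: char_poly_matrix_def\<close>)
  then have p0: "poly ?p 0 < 0" using neg by simp
  have lc: "lead_coeff ?p = 1" using degree_monic_char_poly[OF A'] by simp
  then obtain N where N: "\<And>x. N \<le> x \<Longrightarrow> 1 \<le> poly ?p x"
    using poly_pinfty_gt_lc[of ?p] by auto
  \<comment> \<open>\<open>N\<close> may be nonpositive; the maximum gives a point to the right of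
    0. The intermediate value theorem then produces a root \<open>t > 0\<close>, an eigenvalue of
    \<open>- A\<close>, whose eigenvector makes the quadratic form of \<open>A\<close>
    negative.\<close>
  have "1 \<le> poly ?p (max N 1)" by (rule N) simp
  moreover have "0 < max N 1" by simp
  ultimately obtain t where t: "0 < t" "poly ?p t = 0"
    using poly_IVT_pos[of 0 "max N 1" ?p] p0 by auto
  then obtain v where "eigenvector (- A) v t"
    using eigenvalue_root_char_poly[OF A'] by (auto simp: eigenvalue_def)
  then have v: "v \<in> carrier_vec n" "v \<noteq> 0\<^sub>v n" "- A *\<^sub>v v = t \<cdot>\<^sub>v v"
    using A by (auto simp: eigenvector_def)
  have "v \<bullet> (- A *\<^sub>v v) = - (v \<bullet> (A *\<^sub>v v))"
    using A v(1) by (simp add: uminus_mult_mat_vec)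
  then have "v \<bullet> (A *\<^sub>v v) = - (t * (v \<bullet> v))"
    using v by simp
  moreover have "0 < v \<bullet> v"
  proof -
    obtain i where i: "i < n" "v $ i \<noteq> 0" using v(1,2) by force
    have "0 < (\<Sum>i = 0..<n. v $ i * v $ i)"
      using i by (intro sum_pos2[of _ i]) (auto simp: zero_less_mult_iff linorder_neq_iff)
    then show ?thesis using v(1) by (simp add: scalar_prod_def)
  qed
  ultimately have "v \<bullet> (A *\<^sub>v v) < 0" using t(1) by simp
  then show False using psd[OF v(1)] by simp
qed

text \<open>A vector on the coordinates in \<open>S\<close>, extended by zero, has the same
  quadratic form under \<open>L\<close> as under the submatrix, so the submatrix inherits
  semidefiniteness.\<close>

lemma pminor_nonneg:
  assumes L: "psd m L" and S: "S \<subseteq> {0..<m}"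
  shows "0 \<le> pminor L S"
proof -
  have c: "L \<in> carrier_mat m m" using L by (simp add: psd_def)
  have fS: "finite S" using S finite_subset by blast
  let ?n = "card S"
  let ?A = "mat ?n ?n (\<lambda>(i, j). L $$ (pick S i, pick S j))"
  note bij = bij_betw_pick[OF fS]
  have "0 \<le> v \<bullet> (?A *\<^sub>v v)" if v: "v \<in> carrier_vec ?n" for v
  proof -
    let ?u = "\<lambda>i. v $ inv_into {0..<?n} (pick S) i"
    let ?w = "vec m (\<lambda>i. if i \<in> S then ?u i else 0)"
    have u: "?u (pick S i) = v $ i" if "i < ?n" for i
      using bij_betw_inv_into_left[OF bij, of i] that by simp
    have "v \<bullet> (?A *\<^sub>v v) = (\<Sum>i = 0..<?n. v $ i * (\<Sum>j = 0..<?n. L $$ (pick S i, pick S j) * v $ j))"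
      using v by (simp add: scalar_prod_def)
    also have "\<dots> = (\<Sum>i = 0..<?n. ?u (pick S i) *
        (\<Sum>j = 0..<?n. L $$ (pick S i, pick S j) * ?u (pick S j)))"
      by (intro sum.cong refl) (simp add: u)
    also have "\<dots> = (\<Sum>i = 0..<?n. ?u (pick S i) * (\<Sum>j\<in>S. L $$ (pick S i, j) * ?u j))"
      by (intro sum.cong refl arg_cong2[where f = "(*)"] sum.reindex_bij_betw[OF bij])
    also have "\<dots> = (\<Sum>i\<in>S. ?u i * (\<Sum>j\<in>S. L $$ (i, j) * ?u j))"
      by (rule sum.reindex_bij_betw[OF bij, where g = "\<lambda>i. ?u i * (\<Sum>j\<in>S. L $$ (i, j) * ?u j)"])
    also have "\<dots> = (\<Sum>i\<in>S. ?w $ i * (\<Sum>j = 0..<m. L $$ (i, j) * ?w $ j))"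
      using S by (intro sum.cong refl arg_cong2[where f = "(*)"] sum.mono_neutral_cong_left) auto
    also have "\<dots> = (\<Sum>i = 0..<m. ?w $ i * (\<Sum>j = 0..<m. L $$ (i, j) * ?w $ j))"
      using S by (intro sum.mono_neutral_left) auto
    also have "\<dots> = ?w \<bullet> (L *\<^sub>v ?w)"
      using c by (simp add: scalar_prod_def)
    finally show ?thesis using L by (auto simp: psd_def)
  qed
  then have "0 \<le> Determinant.det ?A"
    by (intro det_nonneg[of _ ?n]) auto
  then show ?thesis
    by (simp add: pminor_def submatrix_eq_mat[OF c S])
qed

section \<open>The coefficients of determinant and adjugate\<close>

text \<open>The coefficient \<open>G_e\<close> of the overview, given by its combinatorial value;
  \<open>coeff_det_weighted_mat\<close> identifies the two.\<close>

definition minor_sum :: "(nat \<Rightarrow> nat \<Rightarrow> real) \<Rightarrow> nat \<Rightarrow> (nat \<Rightarrow> nat) \<Rightarrow> nat \<Rightarrow> real" where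
  "minor_sum a m \<epsilon> e = (\<Sum>S | S \<subseteq> {0..<m} \<and> sum \<epsilon> S = e. perm_det a S)"

text \<open>Arbitrary polynomials \<open>y\<close> are allowed, not only monomials, so that one of
  them can be set to zero when a cofactor is evaluated.\<close>

definition weighted_mat :: "(nat \<Rightarrow> nat \<Rightarrow> real) \<Rightarrow> nat \<Rightarrow> (nat \<Rightarrow> real poly) \<Rightarrow> real poly mat" where
  "weighted_mat a m y = mat m m (\<lambda>(i, j). (if i = j then 1 else 0) + [:a i j:] * y j)"

definition adj_coeff :: "(nat \<Rightarrow> nat \<Rightarrow> real) \<Rightarrow> nat \<Rightarrow> (nat \<Rightarrow> nat) \<Rightarrow> nat \<Rightarrow> nat \<Rightarrow> nat \<Rightarrow> real" where
  "adj_coeff a m \<epsilon> e r c = coeff (adj_mat (weighted_mat a m (\<lambda>i. monom 1 (\<epsilon> i))) $$ (r, c)) e"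

lemma weighted_mat_carrier [simp]: "weighted_mat a m y \<in> carrier_mat m m"
  by (simp add: weighted_mat_def)

lemma det_weighted_mat:
  "Determinant.det (weighted_mat a m y) = (\<Sum>S\<in>Pow {0..<m}. [:perm_det a S:] * (\<Prod>i\<in>S. y i))"
proof -
  have "perm_det (\<lambda>i j. [:a i j:]) S = [:perm_det a S:]" for S
    by (rule perm_det_hom) (simp_all add: pCons_one)
  then show ?thesis
    unfolding weighted_mat_def
    by (simp add: det_eq_perm_det perm_det_one_plus_diag del: mult_pCons_left)
qed

lemma prod_monom_one: "(\<Prod>i\<in>S. monom 1 (\<epsilon> i)) = monom (1::real) (sum \<epsilon> S)"
  by (induction S rule: infinite_finite_induct) (simp_all add: mult_monom)

lemma coeff_det_weighted_mat:
  "coeff (Determinant.det (weighted_mat a m (\<lambda>i. monom 1 (\<epsilon> i)))) e = minor_sum a m \<epsilon> e"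
  by (simp add: det_weighted_mat coeff_sum prod_monom_one minor_sum_def sum.If_cases Int_def
      if_distrib cong: if_cong)

text \<open>Compare coefficients of \<open>z^e\<close> in \<open>M * adj M = det M * I\<close> after
  separating the identity summand of \<open>M\<close>; the remaining summand shifts exponents by
  \<open>\<epsilon> s\<close>.\<close>

lemma adj_coeff_rec:
  assumes rc: "r < m" "c < m"
  shows "adj_coeff a m \<epsilon> e r c = (if r = c then minor_sum a m \<epsilon> e else 0) -
    (\<Sum>s<m. if \<epsilon> s \<le> e then a r s * adj_coeff a m \<epsilon> (e - \<epsilon> s) s c else 0)"
proof -
  let ?M = "weighted_mat a m (\<lambda>i. monom 1 (\<epsilon> i))"
  let ?B = "adj_mat ?M"
  have B: "?B \<in> carrier_mat m m" and MB: "?M * ?B = Determinant.det ?M \<cdot>\<^sub>m 1\<^sub>m m"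
    using adj_mat[OF weighted_mat_carrier] by auto
  have "(?M * ?B) $$ (r, c) = (\<Sum>s = 0..<m. ?M $$ (r, s) * ?B $$ (s, c))"
    using rc B carrier_matD[OF weighted_mat_carrier[of a m "\<lambda>i. monom 1 (\<epsilon> i)"]]
    by (simp add: scalar_prod_def)
  also have "\<dots> = (\<Sum>s = 0..<m. (if r = s then ?B $$ (s, c) else 0) + monom (a r s) (\<epsilon> s) * ?B $$ (s, c))"
    using rc by (intro sum.cong refl) (auto simp: weighted_mat_def smult_monom algebra_simps)
  also have "\<dots> = ?B $$ (r, c) + (\<Sum>s = 0..<m. monom (a r s) (\<epsilon> s) * ?B $$ (s, c))"
    using rc by (simp add: sum.distrib)
  finally have "?B $$ (r, c) =
      (if r = c then Determinant.det ?M else 0) - (\<Sum>s = 0..<m. monom (a r s) (\<epsilon> s) * ?B $$ (s, c))"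
    using rc by (auto simp: MB eq_diff_eq eq_neg_iff_add_eq_0)
  then have "adj_coeff a m \<epsilon> e r c = coeff \<dots> e"
    by (simp add: adj_coeff_def)
  also have "\<dots> = (if r = c then minor_sum a m \<epsilon> e else 0) -
      (\<Sum>s = 0..<m. coeff (monom (a r s) (\<epsilon> s) * ?B $$ (s, c)) e)"
    by (simp add: coeff_sum coeff_det_weighted_mat)
  also have "(\<Sum>s = 0..<m. coeff (monom (a r s) (\<epsilon> s) * ?B $$ (s, c)) e) =
      (\<Sum>s<m. if \<epsilon> s \<le> e then a r s * adj_coeff a m \<epsilon> (e - \<epsilon> s) s c else 0)"
    by (intro sum.cong) (auto simp: coeff_monom_mult adj_coeff_def)
  finally show ?thesis .
qed

text \<open>A diagonal cofactor is the determinant after its column has been replaced by a unit vector, that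
  is, with the corresponding monomial set to zero.\<close>

lemma adj_coeff_diag:
  assumes s: "s < m"
  shows "adj_coeff a m \<epsilon> e s s = (\<Sum>S | S \<subseteq> {0..<m} \<and> sum \<epsilon> S = e \<and> s \<notin> S. perm_det a S)"
proof -
  let ?y = "\<lambda>i. monom (1::real) (\<epsilon> i)"
  let ?M = "weighted_mat a m ?y"
  let ?M' = "weighted_mat a m (?y(s := 0))"
  \<comment> \<open>The two matrices differ only in column \<open>s\<close>, which the deletion
    removes.\<close>
  have "mat_delete ?M s s = mat_delete ?M' s s"
    by (rule eq_matI) (auto simp: mat_delete_def weighted_mat_def)
  then have "cofactor ?M s s = cofactor ?M' s s"
    by (simp add: cofactor_def)
  moreover have "Determinant.det ?M' = (\<Sum>i<m. ?M' $$ (i, s) * cofactor ?M' i s)"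
    by (rule laplace_expansion_column[OF weighted_mat_carrier s])
  moreover have "\<dots> = (\<Sum>i<m. if i = s then cofactor ?M' i s else 0)"
    using s by (intro sum.cong) (auto simp: weighted_mat_def)
  moreover have "adj_mat ?M $$ (s, s) = cofactor ?M s s"
    using s by (simp add: adj_mat_def weighted_mat_def)
  ultimately have "adj_mat ?M $$ (s, s) = Determinant.det ?M'"
    using s by simp
  also have "\<dots> = (\<Sum>S\<in>Pow {0..<m}. [:perm_det a S:] * (\<Prod>i\<in>S. (?y(s := 0)) i))"
    by (rule det_weighted_mat)
  also have "\<dots> = (\<Sum>S\<in>Pow {0..<m}. if s \<notin> S then monom (perm_det a S) (sum \<epsilon> S) else 0)"
  proof (rule sum.cong[OF refl])
    fix S assume "S \<in> Pow {0..<m}"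
    then have fS: "finite S" using finite_subset by auto
    show "[:perm_det a S:] * (\<Prod>i\<in>S. (?y(s := 0)) i) =
        (if s \<notin> S then monom (perm_det a S) (sum \<epsilon> S) else 0)"
    proof (cases "s \<in> S")
      case True
      then have "(\<Prod>i\<in>S. (?y(s := 0)) i) = 0"
        using fS by (intro prod_zero) (auto intro!: bexI[of _ s])
      then show ?thesis using True by simp
    next
      case False
      then have "(\<Prod>i\<in>S. (?y(s := 0)) i) = (\<Prod>i\<in>S. ?y i)"
        by (intro prod.cong) auto
      then show ?thesis using False by (simp add: prod_monom_one smult_monom)
    qed
  qed
  finally have "adj_coeff a m \<epsilon> e s s =
      (\<Sum>S\<in>Pow {0..<m}. if sum \<epsilon> S = e \<and> s \<notin> S then perm_det a S else 0)"
    unfolding adj_coeff_def by (simp add: coeff_sum) (intro sum.cong, auto)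
  also have "\<dots> = (\<Sum>S | S \<subseteq> {0..<m} \<and> sum \<epsilon> S = e \<and> s \<notin> S. perm_det a S)"
    by (simp add: sum.If_cases Int_def)
  finally show ?thesis .
qed

lemma finite_minor_index [simp]: "finite {S. S \<subseteq> {0..<m::nat} \<and> Q S}"
  by (rule finite_subset[of _ "Pow {0..<m}"]) auto

text \<open>Euler's identity for the generating polynomial: the diagonal entries of the adjugate collect
  the minors that avoid an index.\<close>

lemma minor_sum_trace:
  "real e * minor_sum a m \<epsilon> e = (\<Sum>s<m. real (\<epsilon> s) * (minor_sum a m \<epsilon> e - adj_coeff a m \<epsilon> e s s))"
proof -
  let ?F = "{S. S \<subseteq> {0..<m} \<and> sum \<epsilon> S = e}"
  have "(\<Sum>s<m. real (\<epsilon> s) * (minor_sum a m \<epsilon> e - adj_coeff a m \<epsilon> e s s)) =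
      (\<Sum>s<m. \<Sum>S\<in>?F. if s \<in> S then real (\<epsilon> s) * perm_det a S else 0)"
  proof (rule sum.cong[OF refl])
    fix s assume "s \<in> {..<m}"
    then have s: "s < m" by simp
    have "{S. S \<subseteq> {0..<m} \<and> sum \<epsilon> S = e \<and> s \<notin> S} = ?F \<inter> {S. s \<notin> S}" by auto
    then have "adj_coeff a m \<epsilon> e s s = (\<Sum>S\<in>?F. if s \<notin> S then perm_det a S else 0)"
      by (simp add: adj_coeff_diag[OF s] sum.If_cases)
    then have "minor_sum a m \<epsilon> e - adj_coeff a m \<epsilon> e s s =
        (\<Sum>S\<in>?F. perm_det a S - (if s \<notin> S then perm_det a S else 0))"
      by (simp add: minor_sum_def sum_subtractf)
    then show "real (\<epsilon> s) * (minor_sum a m \<epsilon> e - adj_coeff a m \<epsilon> e s s) =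
        (\<Sum>S\<in>?F. if s \<in> S then real (\<epsilon> s) * perm_det a S else 0)"
      by (simp add: sum_distrib_left) (intro sum.cong, auto)
  qed
  also have "\<dots> = (\<Sum>S\<in>?F. \<Sum>s<m. if s \<in> S then real (\<epsilon> s) * perm_det a S else 0)"
    by (rule sum.swap)
  also have "\<dots> = (\<Sum>S\<in>?F. real e * perm_det a S)"
  proof (rule sum.cong[OF refl])
    fix S assume S: "S \<in> ?F"
    then have "{..<m} \<inter> S = S" by auto
    then have "(\<Sum>s<m. if s \<in> S then real (\<epsilon> s) * perm_det a S else 0) =
        (\<Sum>s\<in>S. real (\<epsilon> s)) * perm_det a S"
      by (simp add: sum.If_cases Int_def sum_distrib_right)
    also have "(\<Sum>s\<in>S. real (\<epsilon> s)) = real e"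
      using S by (simp flip: of_nat_sum)
    finally show "(\<Sum>s<m. if s \<in> S then real (\<epsilon> s) * perm_det a S else 0) = real e * perm_det a S" .
  qed
  finally show ?thesis
    by (simp add: minor_sum_def sum_distrib_left)
qed

text \<open>Positive weights leave only the empty set at exponent zero. This value starts the
  recursion, because the trace identity reads \<open>0 = 0\<close> there.\<close>

lemma minor_sum_zero:
  assumes "\<And>i. i < m \<Longrightarrow> 0 < \<epsilon> i"
  shows "minor_sum a m \<epsilon> 0 = 1"
proof -
  have "S = {}" if "S \<subseteq> {0..<m}" "sum \<epsilon> S = 0" for S
  proof -
    have "finite S" using that finite_subset by auto
    then show ?thesis using that assms by fastforce
  qed
  then have "{S. S \<subseteq> {0..<m} \<and> sum \<epsilon> S = 0} = {{}}" by auto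
  then show ?thesis by (simp add: minor_sum_def perm_det_def)
qed

section \<open>Encoding the constraints by weights\<close>

lemma radix_less:
  fixes f :: "nat \<Rightarrow> nat"
  assumes "\<And>j. j < n \<Longrightarrow> f j < B"
  shows "(\<Sum>j<n. f j * B ^ j) < B ^ n"
  using assms
proof (induction n)
  case (Suc n)
  have "Suc (f n) * B ^ n \<le> B * B ^ n"
    using Suc.prems[of n] by (intro mult_right_mono) auto
  then show ?case using Suc by simp
qed simp

lemma radix_unique:
  fixes f g :: "nat \<Rightarrow> nat"
  assumes "\<And>j. j < n \<Longrightarrow> f j < B" "\<And>j. j < n \<Longrightarrow> g j < B"
    and "(\<Sum>j<n. f j * B ^ j) = (\<Sum>j<n. g j * B ^ j)" and "j < n"
  shows "f j = g j"
  using assms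
proof (induction n arbitrary: j)
  case (Suc n)
  let ?s = "\<lambda>f. \<Sum>j<n. f j * B ^ j"
  have less: "?s f < B ^ n" "?s g < B ^ n"
    using Suc.prems(1,2) by (auto intro!: radix_less)
  have eq: "?s f + f n * B ^ n = ?s g + g n * B ^ n"
    using Suc.prems(3) by simp
  \<comment> \<open>The lower digits together stay below \<open>B ^ n\<close>, so division by
    \<open>B ^ n\<close> isolates the top digit.\<close>
  have "(x + k * c) div c = k" if "x < c" for x k c :: nat
    using that by simp
  from this[OF less(1), of "f n"] this[OF less(2), of "g n"] have top: "f n = g n"
    unfolding eq by (rule trans[OF sym])
  have "?s f = ?s g" using eq unfolding top by (rule add_right_imp_eq)
  then have "f j = g j" if "j < n" using Suc.IH[OF _ _ _ that] Suc.prems(1,2) by simp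
  then show ?case using top Suc.prems(4) by (cases "j = n") simp_all
qed simp

text \<open>For \<open>x\<close> in the ground set only the part containing \<open>x\<close>
  contributes, so the value is a single power. The form as a sum is what the program accumulates
  from the incidence table.\<close>

definition base_weight :: "nat \<Rightarrow> nat \<Rightarrow> (nat \<Rightarrow> nat set) \<Rightarrow> nat \<Rightarrow> nat" where
  "base_weight m p P x = (\<Sum>j<p. if x \<in> P j then (m + 1) ^ j else 0)"

text \<open>The digit of $(m+1)^p$ counts the selected elements among the decided ones, and a rejected
  element alone exceeds every target weight.\<close>

definition cond_weight :: "nat \<Rightarrow> nat \<Rightarrow> (nat \<Rightarrow> nat set) \<Rightarrow> nat \<Rightarrow> nat set \<Rightarrow> nat \<Rightarrow> nat" where
  "cond_weight m p P i A x =
    (if i \<le> x then base_weight m p P x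
     else if x \<in> A then base_weight m p P x + (m + 1) ^ p
     else (m + 1) ^ (p + 1))"

definition target_weight :: "nat \<Rightarrow> nat \<Rightarrow> (nat \<Rightarrow> nat) \<Rightarrow> nat" where
  "target_weight m p b = (\<Sum>j<p. b j * (m + 1) ^ j)"

lemma partition_data_le:
  assumes "partition_data m p P b" "j < p"
  shows "P j \<subseteq> {0..<m}" "card (P j) \<le> m" "b j \<le> m"
proof -
  show *: "P j \<subseteq> {0..<m}" using assms unfolding partition_data_def by blast
  show "card (P j) \<le> m" using card_mono[OF _ *] by simp
  then show "b j \<le> m" using assms unfolding partition_data_def by (meson le_trans)
qed

text \<open>The parts cover the ground set. Positivity of the weights is what makes the recursion
  refer to strictly smaller exponents.\<close>

lemma base_weight_pos:
  assumes "partition_data m p P b" "x < m"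
  shows "0 < base_weight m p P x"
proof -
  have "x \<in> (\<Union>j<p. P j)" using assms by (auto simp: partition_data_def)
  then obtain j where "j < p" "x \<in> P j" by auto
  then show ?thesis
    unfolding base_weight_def by (intro sum_pos2[of _ j]) auto
qed

lemma cond_weight_pos:
  assumes "partition_data m p P b" "x < m"
  shows "0 < cond_weight m p P i A x"
  using base_weight_pos[OF assms] by (simp add: cond_weight_def)

lemma sum_base_weight:
  assumes "finite S"
  shows "sum (base_weight m p P) S = (\<Sum>j<p. card (S \<inter> P j) * (m + 1) ^ j)"
proof -
  have "sum (base_weight m p P) S = (\<Sum>j<p. \<Sum>x\<in>S. if x \<in> P j then (m + 1) ^ j else 0)"
    unfolding base_weight_def by (rule sum.swap)
  also have "\<dots> = (\<Sum>j<p. card (S \<inter> P j) * (m + 1) ^ j)"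
    using assms by (intro sum.cong refl) (simp add: sum.If_cases Int_def)
  finally show ?thesis .
qed

text \<open>Serves twice: a rejected element alone outweighs the target, and the number of exponents
  that the program runs through is bounded.\<close>

lemma target_weight_less:
  assumes pd: "partition_data m p P b" and A: "A \<subseteq> {0..<m}"
  shows "target_weight m p b + card A * (m + 1) ^ p < (m + 1) ^ (p + 1)"
proof -
  have "card A \<le> m" using card_mono[OF _ A] by simp
  then have "(\<Sum>j<p + 1. (if j < p then b j else card A) * (m + 1) ^ j) < (m + 1) ^ (p + 1)"
    using partition_data_le(3)[OF pd] by (intro radix_less) (auto simp: less_Suc_eq_le)
  then show ?thesis by (simp add: target_weight_def)
qed

text \<open>If \<open>S\<close> contains a rejected element, its weight already exceeds the target.
  Otherwise \<open>S \<inter> {0..<i} \<subseteq> A\<close> and both sides are expansions with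
  \<open>p + 1\<close> digits at most \<open>m\<close>, which must agree digit by digit. The top
  digit compares cardinalities only, and together with the inclusion this gives equality with
  \<open>A\<close>.\<close>

lemma sum_cond_weight_iff:
  assumes pd: "partition_data m p P b" and i: "i \<le> m" and A: "A \<subseteq> {0..<i}" and S: "S \<subseteq> {0..<m}"
  shows "sum (cond_weight m p P i A) S = target_weight m p b + card A * (m + 1) ^ p \<longleftrightarrow>
    S \<in> partition_family m p P b \<and> S \<inter> {0..<i} = A"
    (is "?l = ?K \<longleftrightarrow> ?r")
proof (cases "S \<inter> {0..<i} \<subseteq> A")
  case False
  have fS: "finite S" using S finite_subset by auto
  from False obtain x where x: "x \<in> S" "x < i" "x \<notin> A" by fastforce
  have "cond_weight m p P i A x \<le> ?l"
    using fS x by (intro member_le_sum) auto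
  moreover have "?K < (m + 1) ^ (p + 1)"
    using target_weight_less[OF pd, of A] A i by fastforce
  ultimately have "?l \<noteq> ?K" using x by (simp add: cond_weight_def)
  then show ?thesis using False by auto
next
  case True
  have fS: "finite S" using S finite_subset by auto
  have fA: "finite A" using A finite_subset by auto
  have cardS: "card (S \<inter> X) \<le> m" for X
    using card_mono[of "{0..<m}" "S \<inter> X"] S by auto
  have cardA: "card A \<le> m"
    using card_mono[of "{0..<i}" A] A i by simp
  have "?l = (\<Sum>x\<in>S. base_weight m p P x + (if x \<in> {0..<i} then (m + 1) ^ p else 0))"
    using True by (intro sum.cong refl) (auto simp: cond_weight_def)
  also have "\<dots> = sum (base_weight m p P) S + (\<Sum>x\<in>S. if x \<in> {0..<i} then (m + 1) ^ p else 0)"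
    by (rule sum.distrib)
  also have "(\<Sum>x\<in>S. if x \<in> {0..<i} then (m + 1) ^ p else 0) = card (S \<inter> {0..<i}) * (m + 1) ^ p"
    using fS by (simp add: sum.If_cases Int_def)
  finally have l: "?l = (\<Sum>j<p + 1. (if j < p then card (S \<inter> P j) else card (S \<inter> {0..<i})) * (m + 1) ^ j)"
    by (simp add: sum_base_weight[OF fS])
  have K: "?K = (\<Sum>j<p + 1. (if j < p then b j else card A) * (m + 1) ^ j)"
    by (simp add: target_weight_def)
  show ?thesis
  proof
    assume eq: "?l = ?K"
    have digit: "(if j < p then card (S \<inter> P j) else card (S \<inter> {0..<i})) = (if j < p then b j else card A)"
      if "j < p + 1" for j
      by (rule radix_unique[OF _ _ eq[unfolded l K] that])
        (use cardS cardA partition_data_le(3)[OF pd] in \<open>auto simp: less_Suc_eq_le\<close>)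
    have "S \<inter> {0..<i} = A"
      using True fA digit[of p] by (intro card_subset_eq) auto
    moreover have "card (S \<inter> P j) = b j" if "j < p" for j
      using digit[of j] that by simp
    ultimately show ?r using S by (simp add: partition_family_def)
  next
    assume ?r
    then show "?l = ?K" unfolding l K by (auto simp: partition_family_def intro!: sum.cong)
  qed
qed

section \<open>The masses \<open>Z_i(A)\<close> and the chain rule for sequential decisions\<close>

definition cond_mass :: "real mat \<Rightarrow> nat set set \<Rightarrow> nat \<Rightarrow> nat set \<Rightarrow> real" where
  "cond_mass L C i A = (\<Sum>S | S \<in> C \<and> S \<inter> {0..<i} = A. pminor L S)"

lemma finite_partition_family [simp]: "finite (partition_family m p P b)"
  by (rule finite_subset[of _ "Pow {0..<m}"]) (auto simp: partition_family_def)

lemma minor_sum_cond_weight: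
  assumes L: "L \<in> carrier_mat m m" and pd: "partition_data m p P b" and i: "i \<le> m" and A: "A \<subseteq> {0..<i}"
  shows "minor_sum (\<lambda>i j. L $$ (i, j)) m (cond_weight m p P i A)
      (target_weight m p b + card A * (m + 1) ^ p) =
    cond_mass L (partition_family m p P b) i A"
proof -
  have "{S. S \<subseteq> {0..<m} \<and> sum (cond_weight m p P i A) S = target_weight m p b + card A * (m + 1) ^ p} =
      {S. S \<in> partition_family m p P b \<and> S \<inter> {0..<i} = A}"
    using sum_cond_weight_iff[OF pd i A] by (auto simp: partition_family_def)
  then show ?thesis
    unfolding minor_sum_def cond_mass_def
    by (simp, intro sum.cong) (auto simp: pminor_eq_perm_det[OF L] partition_family_def)
qed

text \<open>Distinguish whether \<open>i\<close> belongs to \<open>S\<close>. The program computes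
  only the two summands and takes their sum as the denominator of the bias.\<close>

lemma cond_mass_split:
  assumes "finite C" "A \<subseteq> {0..<i}"
  shows "cond_mass L C i A = cond_mass L C (Suc i) A + cond_mass L C (Suc i) (insert i A)"
proof -
  have "{S. S \<in> C \<and> S \<inter> {0..<i} = A} = {S. S \<in> C \<and> S \<inter> {0..<Suc i} = A} \<union>
      {S. S \<in> C \<and> S \<inter> {0..<Suc i} = insert i A}" (is "?X = ?Y \<union> ?Z")
  proof (rule Set.set_eqI)
    fix S
    have "S \<inter> {0..<Suc i} = (if i \<in> S then insert i (S \<inter> {0..<i}) else S \<inter> {0..<i})"
      by (auto simp: less_Suc_eq)
    moreover have "i \<notin> A" using assms by auto
    ultimately show "S \<in> ?X \<longleftrightarrow> S \<in> ?Y \<union> ?Z" by auto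
  qed
  moreover have "?Y \<inter> ?Z = {}" using assms by auto
  ultimately show ?thesis
    using assms by (simp add: cond_mass_def sum.union_disjoint)
qed

lemma cond_mass_nonneg:
  assumes "psd m L" "\<And>S. S \<in> C \<Longrightarrow> S \<subseteq> {0..<m}"
  shows "0 \<le> cond_mass L C i A"
  unfolding cond_mass_def using assms by (intro sum_nonneg pminor_nonneg) auto

text \<open>The law of the final set once the first \<open>i\<close> decisions have produced
  \<open>A\<close>: the target law at \<open>i = 0\<close>, a point mass at \<open>i = m\<close>. It
  serves as the distributional invariant of the loop.\<close>

definition cond_prob :: "real mat \<Rightarrow> nat set set \<Rightarrow> nat \<Rightarrow> nat set \<Rightarrow> nat set \<Rightarrow> real" where
  "cond_prob L C i A S = (if S \<inter> {0..<i} = A then pminor L S / cond_mass L C i A else 0)"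

text \<open>The chain rule: in each product the mass of the chosen branch cancels, leaving the minor
  over \<open>cond_mass L C i A\<close>, and a set \<open>S\<close> that agrees with
  \<open>A\<close> below \<open>i\<close> belongs to exactly one branch.\<close>

lemma cond_prob_step:
  assumes L: "psd m L" and C: "\<And>S. S \<in> C \<Longrightarrow> S \<subseteq> {0..<m}" and A: "A \<subseteq> {0..<i}"
    and pos: "0 < cond_mass L C i A" and S: "S \<in> C"
  defines "\<beta> \<equiv> cond_mass L C (Suc i) (insert i A) / cond_mass L C i A"
  shows "\<beta> * cond_prob L C (Suc i) (insert i A) S + (1 - \<beta>) * cond_prob L C (Suc i) A S =
    cond_prob L C i A S"
proof -
  let ?z = "cond_mass L C (Suc i)"
  have finC: "finite C" using C by (intro finite_subset[of C "Pow {0..<m}"]) auto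
  have sum: "cond_mass L C i A = ?z A + ?z (insert i A)"
    by (rule cond_mass_split[OF finC A])
  \<comment> \<open>In a branch of mass zero nothing can be cancelled. But there nonnegative minors
    sum to zero, so each of them vanishes and both sides are zero.\<close>
  have null: "pminor L S = 0" if "?z A' = 0" "S \<inter> {0..<Suc i} = A'" for A'
  proof -
    have "\<forall>T\<in>{T. T \<in> C \<and> T \<inter> {0..<Suc i} = A'}. pminor L T = 0"
      using that(1) finC pminor_nonneg[OF L C] unfolding cond_mass_def
      by (subst (asm) sum_nonneg_eq_0_iff) auto
    then show ?thesis using that(2) S by auto
  qed
  have one: "\<beta> * cond_prob L C (Suc i) (insert i A) S =
      (if S \<inter> {0..<Suc i} = insert i A then pminor L S / cond_mass L C i A else 0)"
    using null[of "insert i A"] by (auto simp: \<beta>_def cond_prob_def)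
  have "1 - \<beta> = ?z A / cond_mass L C i A"
    using pos unfolding \<beta>_def sum by (simp add: field_simps)
  then have zero: "(1 - \<beta>) * cond_prob L C (Suc i) A S =
      (if S \<inter> {0..<Suc i} = A then pminor L S / cond_mass L C i A else 0)"
    using null[of A] by (auto simp: cond_prob_def)
  have "S \<inter> {0..<Suc i} = (if i \<in> S then insert i (S \<inter> {0..<i}) else S \<inter> {0..<i})"
    by (auto simp: less_Suc_eq)
  moreover have "i \<notin> A" using A by auto
  ultimately show ?thesis
    unfolding one zero by (auto simp: cond_prob_def)
qed

section \<open>Deterministic program fragments\<close>

lemma nats_put_nat [simp]:
  "nats (put_nat x is k s) y = (if y = x then (nats s x)(is := k) else nats s y)"
  by (simp add: put_nat_def)

lemma reals_put_nat [simp]: "reals (put_nat x is k s) = reals s"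
  by (simp add: put_nat_def)

lemma nats_put_real [simp]: "nats (put_real x is v s) = nats s"
  by (simp add: put_real_def)

lemma reals_put_real [simp]:
  "reals (put_real x is v s) y = (if y = x then (reals s x)(is := v) else reals s y)"
  by (simp add: put_real_def)

text \<open>A total-correctness triple with time bound for coin-free fragments: the outcome is a
  point mass, so all of the numerical work is verified without probabilities.\<close>

definition runs_to :: "com \<Rightarrow> (state \<Rightarrow> bool) \<Rightarrow> nat \<Rightarrow> state \<Rightarrow> bool" where
  "runs_to c Q T s \<longleftrightarrow> (\<exists>s' t. exec c s (return_pmf (s', t)) \<and> t \<le> T \<and> Q s')"

lemma charge_return [simp]: "charge k (return_pmf (s, t)) = return_pmf (s, k + t)"
  by (simp add: charge_def)

lemma followed_by_return [simp]: "followed_by (return_pmf (s, t)) K = charge t (K s)"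
  by (simp add: followed_by_def bind_return_pmf)

lemma runs_to_mono:
  "runs_to c Q T s \<Longrightarrow> (\<And>s'. Q s' \<Longrightarrow> Q' s') \<Longrightarrow> T \<le> T' \<Longrightarrow> runs_to c Q' T' s"
  unfolding runs_to_def by (meson le_trans)

lemma runs_to_Skip: "Q s \<Longrightarrow> 1 \<le> T \<Longrightarrow> runs_to Skip Q T s"
  unfolding runs_to_def using exec.Skip by blast

lemma runs_to_SetN:
  "Q (put_nat x (map (nval s) is) (nval s a) s) \<Longrightarrow> 1 + sum_list (map ncost is) + ncost a \<le> T \<Longrightarrow>
    runs_to (SetN x is a) Q T s"
  unfolding runs_to_def using exec.SetN by blast

lemma runs_to_SetR:
  "Q (put_real x (map (nval s) is) (rval s e) s) \<Longrightarrow> 1 + sum_list (map ncost is) + rcost e \<le> T \<Longrightarrow>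
    runs_to (SetR x is e) Q T s"
  unfolding runs_to_def using exec.SetR by blast

lemma runs_to_Seq:
  assumes "runs_to c P U s" "\<And>s'. P s' \<Longrightarrow> runs_to d Q V s'" "U + V \<le> T"
  shows "runs_to (Seq c d) Q T s"
proof -
  obtain s1 t1 where 1: "exec c s (return_pmf (s1, t1))" "t1 \<le> U" "P s1"
    using assms(1) by (auto simp: runs_to_def)
  obtain s2 t2 where 2: "exec d s1 (return_pmf (s2, t2))" "t2 \<le> V" "Q s2"
    using assms(2)[OF 1(3)] by (auto simp: runs_to_def)
  have "exec (Seq c d) s (followed_by (return_pmf (s1, t1)) (\<lambda>_. return_pmf (s2, t2)))"
    by (rule exec.Seq[OF 1(1)]) (use 2 in auto)
  then show ?thesis
    using 1(2) 2(2,3) assms(3) by (auto simp: runs_to_def intro!: exI)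
qed

lemma runs_to_Cond:
  assumes "tval s g \<Longrightarrow> runs_to c Q T s" "\<not> tval s g \<Longrightarrow> runs_to d Q T s" "1 + tcost g + T \<le> T'"
  shows "runs_to (Cond g c d) Q T' s"
proof (cases "tval s g")
  case True
  obtain s1 t1 where 1: "exec c s (return_pmf (s1, t1))" "t1 \<le> T" "Q s1"
    using assms(1)[OF True] by (auto simp: runs_to_def)
  show ?thesis
    using exec.CondTrue[OF True 1(1), of d] 1 assms(3) by (auto simp: runs_to_def intro!: exI)
next
  case False
  obtain s1 t1 where 1: "exec d s (return_pmf (s1, t1))" "t1 \<le> T" "Q s1"
    using assms(2)[OF False] by (auto simp: runs_to_def)
  show ?thesis
    using exec.CondFalse[OF False 1(1), of c] 1 assms(3) by (auto simp: runs_to_def intro!: exI)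
qed

text \<open>A loop whose guard holds runs like its body followed by the loop, up to the cost of the
  test. Loops can thus be handled by induction and the rule for sequences.\<close>

lemma runs_to_While_unfold:
  assumes "tval s g" "runs_to (Seq c (While g c)) Q T s" "1 + tcost g + T \<le> T'"
  shows "runs_to (While g c) Q T' s"
proof -
  obtain s2 t2 where "exec (Seq c (While g c)) s (return_pmf (s2, t2))" and t2: "t2 \<le> T" "Q s2"
    using assms(2) by (auto simp: runs_to_def)
  then obtain M K where "return_pmf (s2, t2) = followed_by M K" "exec c s M"
    "\<And>s' t. (s', t) \<in> set_pmf M \<Longrightarrow> exec (While g c) s' (K s')"
    by (cases rule: exec.cases) auto
  then have "exec (While g c) s (charge (1 + tcost g) (return_pmf (s2, t2)))"
    using exec.WhileTrue[OF assms(1)] by metis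
  then show ?thesis
    using t2 assms(3) by (auto simp: runs_to_def intro!: exI)
qed

lemma runs_to_While_end:
  assumes "\<not> tval s g" "Q s" "1 + tcost g \<le> T"
  shows "runs_to (While g c) Q T s"
  unfolding runs_to_def using exec.WhileFalse[OF assms(1), of c] assms(2,3) by blast

definition For :: "name \<Rightarrow> nexp \<Rightarrow> com \<Rightarrow> com" where
  "For x u c = Seq (SetN x [] (NLit 0))
    (While (NLess (NGet x []) u) (Seq c (SetN x [] (NAdd (NGet x []) (NLit 1)))))"

text \<open>The bound \<open>u\<close> is evaluated afresh in every round, hence \<open>inv\<close>
  has to fix its value. A round costs \<open>T\<close> for the body, 4 for the increment and
  \<open>3 + ncost u\<close> for the test; initialization and the last test account for
  \<open>5 + ncost u\<close>.\<close>

lemma runs_to_For: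
  assumes init: "I 0 (put_nat x [] 0 s)"
    and inv: "\<And>k s'. I k s' \<Longrightarrow> nats s' x [] = k \<and> nval s' u = n"
    and body: "\<And>k s'. k < n \<Longrightarrow> I k s' \<Longrightarrow>
      runs_to c (\<lambda>s''. nats s'' x [] = k \<and> I (Suc k) (put_nat x [] (Suc k) s'')) T s'"
    and post: "\<And>s'. I n s' \<Longrightarrow> Q s'"
    and time: "n * (T + 7 + ncost u) + 5 + ncost u \<le> T'"
  shows "runs_to (For x u c) Q T' s"
proof -
  let ?D = "T + 7 + ncost u"
  let ?b = "Seq c (SetN x [] (NAdd (NGet x []) (NLit 1)))"
  let ?w = "While (NLess (NGet x []) u) ?b"
  have loop: "\<forall>s. I k s \<longrightarrow> runs_to ?w (I n) ((n - k) * ?D + 3 + ncost u) s" if "k \<le> n" for k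
    using that
  proof (induction k rule: inc_induct)
    case base
    show ?case
      using inv by (auto intro!: runs_to_While_end)
  next
    case (step k)
    show ?case
    proof (intro allI impI)
      fix s assume s: "I k s"
      have "runs_to ?b (I (Suc k)) (T + 4) s"
        by (rule runs_to_Seq[OF body[OF step.hyps(2) s]]) (auto intro!: runs_to_SetN)
      then have "runs_to (Seq ?b ?w) (I n) (T + 4 + ((n - Suc k) * ?D + 3 + ncost u)) s"
        by (rule runs_to_Seq) (use step.IH in auto)
      moreover have "n - k = Suc (n - Suc k)" using step.hyps by simp
      ultimately show "runs_to ?w (I n) ((n - k) * ?D + 3 + ncost u) s"
        using inv[OF s] step.hyps by (intro runs_to_While_unfold) auto
    qed
  qed
  have "runs_to (For x u c) (I n) (2 + (n * ?D + 3 + ncost u)) s"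
    unfolding For_def
    by (rule runs_to_Seq[where P = "I 0" and U = 2 and V = "n * ?D + 3 + ncost u"])
      (use init loop[of 0] in \<open>auto intro!: runs_to_SetN\<close>)
  then show ?thesis
    by (rule runs_to_mono) (use post time in auto)
qed

definition same_except :: "name set \<Rightarrow> name set \<Rightarrow> state \<Rightarrow> state \<Rightarrow> bool" where
  "same_except X R s s' \<longleftrightarrow>
    (\<forall>x. x \<notin> X \<longrightarrow> nats s' x = nats s x) \<and> (\<forall>x. x \<notin> R \<longrightarrow> reals s' x = reals s x)"

lemma same_except_refl [simp]: "same_except X R s s"
  by (simp add: same_except_def)

lemma same_except_put_nat [simp]:
  "x \<in> X \<Longrightarrow> same_except X R s (put_nat x is k s') = same_except X R s s'"
  by (auto simp: same_except_def)

lemma same_except_put_real [simp]: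
  "x \<in> R \<Longrightarrow> same_except X R s (put_real x is v s') = same_except X R s s'"
  by (auto simp: same_except_def)

lemma same_except_trans:
  "same_except X R s s' \<Longrightarrow> same_except X' R' s' s'' \<Longrightarrow> X \<subseteq> Y \<Longrightarrow> X' \<subseteq> Y \<Longrightarrow> R \<subseteq> Z \<Longrightarrow> R' \<subseteq> Z \<Longrightarrow>
    same_except Y Z s s''"
  unfolding same_except_def by (metis subsetD)

lemma same_except_nats: "same_except X R s s' \<Longrightarrow> x \<notin> X \<Longrightarrow> nats s' x = nats s x"
  by (simp add: same_except_def)

lemma same_except_reals: "same_except X R s s' \<Longrightarrow> x \<notin> R \<Longrightarrow> reals s' x = reals s x"
  by (simp add: same_except_def)

section \<open>Random program fragments\<close>

lemma followed_by_assoc: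
  "followed_by (followed_by M K) K' = followed_by M (\<lambda>s. followed_by (K s) K')"
proof -
  have "charge t (bind_pmf N (\<lambda>(s, u). charge u (K' s))) = bind_pmf (charge t N) (\<lambda>(s, u). charge u (K' s))"
    for t N
    unfolding charge_def by (simp add: map_bind_pmf bind_map_pmf case_prod_unfold pmf.map_comp o_def add.assoc)
  then show ?thesis
    unfolding followed_by_def by (simp add: bind_assoc_pmf case_prod_unfold)
qed

lemma set_followed_by:
  "(s', t) \<in> set_pmf (followed_by M K) \<longleftrightarrow>
    (\<exists>s1 t1 t2. (s1, t1) \<in> set_pmf M \<and> (s', t2) \<in> set_pmf (K s1) \<and> t = t1 + t2)"
  by (force simp: followed_by_def charge_def case_prod_unfold)

lemma exec_Seq_iff:
  "exec (Seq c d) s N \<longleftrightarrow> (\<exists>M K. N = followed_by M K \<and> exec c s M \<and>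
    (\<forall>s' t. (s', t) \<in> set_pmf M \<longrightarrow> exec d s' (K s')))"
proof
  assume "exec (Seq c d) s N"
  then show "\<exists>M K. N = followed_by M K \<and> exec c s M \<and>
      (\<forall>s' t. (s', t) \<in> set_pmf M \<longrightarrow> exec d s' (K s'))"
    by (cases rule: exec.cases) auto
qed (auto intro: exec.Seq)

lemma exec_Seq_assoc:
  assumes "exec (Seq a (Seq b c)) s N"
  shows "exec (Seq (Seq a b) c) s N"
proof -
  obtain M K where N: "N = followed_by M K" and a: "exec a s M"
    and bc: "\<And>s' t. (s', t) \<in> set_pmf M \<Longrightarrow> exec (Seq b c) s' (K s')"
    using assms unfolding exec_Seq_iff[of a] by blast
  \<comment> \<open>The derivation may split \<open>K s'\<close> differently for each intermediate
    state, whereas sequencing needs one continuation for all states. By determinism the chosen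
    distributions agree with all of these splittings.\<close>
  define Kb where "Kb s' = (SOME B. exec b s' B)" for s'
  define Kc where "Kc s' = (SOME B. exec c s' B)" for s'
  have Kb: "exec b s' B \<Longrightarrow> Kb s' = B" for s' B
    unfolding Kb_def by (rule some_equality) (auto intro: exec_deterministic)
  have Kc: "exec c s' B \<Longrightarrow> Kc s' = B" for s' B
    unfolding Kc_def by (rule some_equality) (auto intro: exec_deterministic)
  have split: "K s' = followed_by (Kb s') Kc" "exec b s' (Kb s')"
      "\<And>s'' u. (s'', u) \<in> set_pmf (Kb s') \<Longrightarrow> exec c s'' (Kc s'')"
    if mem: "(s', t) \<in> set_pmf M" for s' t
  proof -
    obtain B J where B: "K s' = followed_by B J" "exec b s' B"
      "\<And>s'' u. (s'', u) \<in> set_pmf B \<Longrightarrow> exec c s'' (J s'')"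
      using bc[OF mem] unfolding exec_Seq_iff by blast
    have [simp]: "Kb s' = B" by (rule Kb[OF B(2)])
    have J: "\<And>s'' u. (s'', u) \<in> set_pmf B \<Longrightarrow> Kc s'' = J s''"
      by (rule Kc) (rule B(3))
    show "K s' = followed_by (Kb s') Kc"
      using B(1) J by (auto intro!: followed_by_cong)
    show "exec b s' (Kb s')" using B by simp
    show "\<And>s'' u. (s'', u) \<in> set_pmf (Kb s') \<Longrightarrow> exec c s'' (Kc s'')"
      using B(3) J by simp
  qed
  have "exec (Seq (Seq a b) c) s (followed_by (followed_by M Kb) Kc)"
    by (intro exec.Seq a) (auto simp: set_followed_by dest: split)
  moreover have "N = followed_by (followed_by M Kb) Kc"
    unfolding N followed_by_assoc by (rule followed_by_cong) (rule split)
  ultimately show ?thesis by simp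
qed

lemma map_followed_by:
  "map_pmf (\<lambda>(s', t). out s') (followed_by M K) =
    bind_pmf M (\<lambda>(s, t). map_pmf (\<lambda>(s', t). out s') (K s))"
  by (simp add: followed_by_def charge_def map_bind_pmf case_prod_unfold pmf.map_comp o_def)

lemma map_charge:
  "map_pmf (\<lambda>(s', t). out s') (charge k M) = map_pmf (\<lambda>(s', t). out s') M"
  by (simp add: charge_def case_prod_unfold pmf.map_comp o_def)

lemma samples_within_mono:
  "samples_within c s out C \<mu> T \<Longrightarrow> (\<And>S. S \<in> C \<Longrightarrow> \<mu> S = \<mu>' S) \<Longrightarrow> T \<le> T' \<Longrightarrow>
    samples_within c s out C \<mu>' T'"
  unfolding samples_within_def by (elim ex_forward) fastforce

lemma samples_within_Seq:
  assumes "runs_to c P U s" "\<And>s'. P s' \<Longrightarrow> samples_within d s' out C \<mu> V"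
  shows "samples_within (Seq c d) s out C \<mu> (U + V)"
proof -
  obtain s1 t1 where 1: "exec c s (return_pmf (s1, t1))" "t1 \<le> U" "P s1"
    using assms(1) by (auto simp: runs_to_def)
  obtain M where M: "exec d s1 M" "\<forall>(s', t) \<in> set_pmf M. out s' \<in> C \<and> t \<le> V"
    "\<forall>S \<in> C. pmf (map_pmf (\<lambda>(s', t). out s') M) S = \<mu> S"
    using assms(2)[OF 1(3)] by (auto simp: samples_within_def)
  have "exec (Seq c d) s (followed_by (return_pmf (s1, t1)) (\<lambda>_. M))"
    by (rule exec.Seq[OF 1(1)]) (use M in auto)
  moreover have "\<forall>(s', t) \<in> set_pmf (charge t1 M). out s' \<in> C \<and> t \<le> U + V"
    using M(2) 1(2) by (fastforce simp: charge_def)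
  ultimately show ?thesis
    using M(3) by (auto simp: samples_within_def map_charge intro!: exI[of _ "charge t1 M"])
qed

lemma exec_Seq_cong:
  assumes "exec (Seq a c) s N" "\<And>s M. exec c s M \<Longrightarrow> exec d s M"
  shows "exec (Seq a d) s N"
  using assms by (force simp: exec_Seq_iff)

text \<open>For a round consisting of \<open>a\<close>, a toss \<open>b\<close> and
  \<open>c\<close>, followed by the remaining loop \<open>d\<close>: the rule for a toss treats
  everything after the coin as one continuation, while the loop closes the round first.\<close>

lemma samples_within_Seq_assoc_inner:
  "samples_within (Seq a (Seq b (Seq c d))) s out C \<mu> T \<Longrightarrow>
    samples_within (Seq (Seq a (Seq b c)) d) s out C \<mu> T"
  unfolding samples_within_def
  using exec_Seq_assoc[of a "Seq b c" d] exec_Seq_cong[OF _ exec_Seq_assoc] by blast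

lemma samples_within_While_unfold:
  assumes "tval s g" "samples_within (Seq c (While g c)) s out C \<mu> T"
  shows "samples_within (While g c) s out C \<mu> (1 + tcost g + T)"
proof -
  obtain N where N: "exec (Seq c (While g c)) s N" "\<forall>(s', t) \<in> set_pmf N. out s' \<in> C \<and> t \<le> T"
    "\<forall>S \<in> C. pmf (map_pmf (\<lambda>(s', t). out s') N) S = \<mu> S"
    using assms(2) by (auto simp: samples_within_def)
  then obtain M K where "N = followed_by M K" "exec c s M"
    "\<And>s' t. (s', t) \<in> set_pmf M \<Longrightarrow> exec (While g c) s' (K s')"
    unfolding exec_Seq_iff by blast
  then have "exec (While g c) s (charge (1 + tcost g) N)"
    using exec.WhileTrue[OF assms(1)] by metis
  moreover have "\<forall>(s', t) \<in> set_pmf (charge (1 + tcost g) N). out s' \<in> C \<and> t \<le> 1 + tcost g + T"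
    using N(2) by (fastforce simp: charge_def)
  ultimately show ?thesis
    using N(3) by (auto simp: samples_within_def map_charge intro!: exI[of _ "charge (1 + tcost g) N"])
qed

lemma samples_within_While_end:
  assumes "\<not> tval s g" "out s \<in> C" "\<And>S. S \<in> C \<Longrightarrow> \<mu> S = (if S = out s then 1 else 0)"
  shows "samples_within (While g c) s out C \<mu> (1 + tcost g)"
  unfolding samples_within_def
  using exec.WhileFalse[OF assms(1), of c] assms(2,3)
  by (intro exI[of _ "return_pmf (s, 1 + tcost g)"]) (auto simp: indicator_def)

text \<open>The output law is the mixture of the laws of the two branches. Each branch hypothesis is
  demanded only if the branch has positive probability: on a branch of mass zero the sampling loop
  satisfies no such guarantee.\<close>

lemma samples_within_Toss:
  fixes e :: rexp and s :: state
  defines "\<beta> \<equiv> rval s e"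
  assumes \<beta>: "0 \<le> \<beta>" "\<beta> \<le> 1"
    and one: "0 < \<beta> \<Longrightarrow> samples_within d (put_nat x (map (nval s) js) 1 s) out C \<mu>1 T"
    and zero: "\<beta> < 1 \<Longrightarrow> samples_within d (put_nat x (map (nval s) js) 0 s) out C \<mu>0 T"
  shows "samples_within (Seq (Toss x js e) d) s out C (\<lambda>S. \<beta> * \<mu>1 S + (1 - \<beta>) * \<mu>0 S)
    (1 + sum_list (map ncost js) + rcost e + T)"
proof -
  let ?st = "\<lambda>h. put_nat x (map (nval s) js) (if h then 1 else 0) s"
  let ?k = "1 + sum_list (map ncost js) + rcost e"
  let ?out = "map_pmf (\<lambda>(s', t). out s')"
  define good where "good \<mu> s' M \<longleftrightarrow> exec d s' M \<and> (\<forall>(s', t) \<in> set_pmf M. out s' \<in> C \<and> t \<le> T) \<and>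
    (\<forall>S \<in> C. pmf (?out M) S = \<mu> S)" for \<mu> s' M
  have good_iff: "samples_within d s' out C \<mu> T \<longleftrightarrow> (\<exists>M. good \<mu> s' M)" for \<mu> s'
    by (simp add: good_def samples_within_def)
  \<comment> \<open>A single continuation for both branches; determinism makes it coincide with
    whatever distribution a branch hypothesis supplies.\<close>
  define K where "K s' = (SOME M. exec d s' M)" for s'
  have K: "good \<mu> s' M \<Longrightarrow> good \<mu> s' (K s')" for \<mu> s' M
    unfolding K_def by (metis exec_deterministic good_def someI_ex)
  let ?M = "map_pmf (\<lambda>h. (?st h, ?k)) (bernoulli_pmf \<beta>)"
  have good: "good (if h then \<mu>1 else \<mu>0) (?st h) (K (?st h))" if "h \<in> set_pmf (bernoulli_pmf \<beta>)" for h
  proof (cases h)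
    case True
    then have "0 < \<beta>" using that \<beta> by (cases "\<beta> = 0") (auto simp: set_pmf_iff)
    then show ?thesis using one True K unfolding good_iff by auto
  next
    case False
    then have "\<beta> < 1" using that \<beta> by (cases "\<beta> = 1") (auto simp: set_pmf_iff)
    then show ?thesis using zero False K unfolding good_iff by auto
  qed
  have M: "exec (Toss x js e) s ?M"
    using exec.Toss[of s e x js] \<beta> unfolding \<beta>_def by simp
  have "exec (Seq (Toss x js e) d) s (followed_by ?M K)"
    by (rule exec.Seq[OF M]) (use good in \<open>auto simp: good_def\<close>)
  moreover have "\<forall>(s', t) \<in> set_pmf (followed_by ?M K). out s' \<in> C \<and> t \<le> ?k + T"
    using good by (fastforce simp: set_followed_by good_def)
  moreover have "pmf (?out (followed_by ?M K)) S = \<beta> * \<mu>1 S + (1 - \<beta>) * \<mu>0 S" if S: "S \<in> C" for S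
  proof -
    have "pmf (?out (followed_by ?M K)) S =
        \<beta> * pmf (?out (K (?st True))) S + (1 - \<beta>) * pmf (?out (K (?st False))) S"
      using \<beta> by (simp add: map_followed_by bind_map_pmf pmf_bind)
    \<comment> \<open>For \<open>\<beta> = 0\<close> nothing is known about the law of this branch,
      but the factor annihilates both sides.\<close>
    moreover have "\<beta> * pmf (?out (K (?st True))) S = \<beta> * \<mu>1 S"
      using good[of True] \<beta> S by (cases "\<beta> = 0") (auto simp: good_def set_pmf_iff)
    moreover have "(1 - \<beta>) * pmf (?out (K (?st False))) S = (1 - \<beta>) * \<mu>0 S"
      using good[of False] \<beta> S by (cases "\<beta> = 1") (auto simp: good_def set_pmf_iff)
    ultimately show ?thesis by (simp only:)
  qed
  ultimately show ?thesis
    unfolding samples_within_def by blast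
qed

section \<open>Computing a coefficient\<close>

text \<open>At \<open>k = m\<close> this is the entry \<open>T_e[r,c]\<close> of the overview;
  smaller \<open>k\<close> give the partial sums of the innermost loop.\<close>

definition shifted_sum ::
    "(nat \<Rightarrow> nat \<Rightarrow> real) \<Rightarrow> nat \<Rightarrow> (nat \<Rightarrow> nat) \<Rightarrow> nat \<Rightarrow> nat \<Rightarrow> nat \<Rightarrow> nat \<Rightarrow> real" where
  "shifted_sum a m \<epsilon> e r c k =
    (\<Sum>s<k. if \<epsilon> s \<le> e then a r s * adj_coeff a m \<epsilon> (e - \<epsilon> s) s c else 0)"

text \<open>Array \<open>B\<close> holds the adjugate coefficients, indexed by exponent, row and column; \<open>G\<close> holds the
  current determinant coefficient; \<open>E\<close> holds the weights and \<open>K\<close> the target weight.\<close>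

definition weights_loaded ::
    "(nat \<Rightarrow> nat \<Rightarrow> real) \<Rightarrow> nat \<Rightarrow> (nat \<Rightarrow> nat) \<Rightarrow> state \<Rightarrow> bool" where
  "weights_loaded a m \<epsilon> s \<longleftrightarrow> nats s ''m'' [] = m \<and> (\<forall>i<m. nats s ''E'' [i] = \<epsilon> i \<and> 0 < \<epsilon> i) \<and>
    (\<forall>i<m. \<forall>j<m. reals s ''L'' [i, j] = a i j)"

lemma weights_loaded_cong:
  "same_except X R s s' \<Longrightarrow> ''m'' \<notin> X \<Longrightarrow> ''E'' \<notin> X \<Longrightarrow> ''L'' \<notin> R \<Longrightarrow>
    weights_loaded a m \<epsilon> s' = weights_loaded a m \<epsilon> s"
  by (simp add: weights_loaded_def same_except_nats same_except_reals)

definition adj_below ::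
    "(nat \<Rightarrow> nat \<Rightarrow> real) \<Rightarrow> nat \<Rightarrow> (nat \<Rightarrow> nat) \<Rightarrow> nat \<Rightarrow> (nat list \<Rightarrow> real) \<Rightarrow> bool" where
  "adj_below a m \<epsilon> e B \<longleftrightarrow> (\<forall>e'<e. \<forall>r<m. \<forall>c<m. B [e', r, c] = adj_coeff a m \<epsilon> e' r c)"

text \<open>Index subtraction truncates at zero, so a weight above \<open>e\<close> has to be
  skipped explicitly; otherwise the layer of exponent zero would be read.\<close>

definition entry_step :: com where
  "entry_step = Cond (NLess (NGet ''e'' []) (NGet ''E'' [NGet ''t'' []]))
    Skip
    (SetR ''B'' [NGet ''e'' [], NGet ''r'' [], NGet ''c'' []]
      (RSub (RGet ''B'' [NGet ''e'' [], NGet ''r'' [], NGet ''c'' []])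
        (RMul (RGet ''L'' [NGet ''r'' [], NGet ''t'' []])
          (RGet ''B'' [NSub (NGet ''e'' []) (NGet ''E'' [NGet ''t'' []]), NGet ''t'' [], NGet ''c'' []]))))"

definition entry_prog :: com where
  "entry_prog = Seq
    (SetR ''B'' [NGet ''e'' [], NGet ''r'' [], NGet ''c'' []] (ROfNat (NLit 0)))
    (For ''t'' (NGet ''m'' []) entry_step)"

lemma runs_to_entry_prog:
  assumes inst: "weights_loaded a m \<epsilon> s"
    and rc: "r < m" "c < m"
    and idx: "nats s ''e'' [] = e" "nats s ''r'' [] = r" "nats s ''c'' [] = c"
    and below: "adj_below a m \<epsilon> e (reals s ''B'')"
  shows "runs_to entry_prog
    (\<lambda>s'. same_except {''t''} {''B''} s s' \<and>
      reals s' ''B'' = (reals s ''B'')([e, r, c] := - shifted_sum a m \<epsilon> e r c m)) (50 * m + 20) s"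
    (is "runs_to _ ?Q _ _")
  unfolding entry_prog_def
proof (rule runs_to_Seq[where P = "\<lambda>s'. s' = put_real ''B'' [e, r, c] 0 s" and U = 10 and V = "50 * m + 6"])
  fix s1 assume s1: "s1 = put_real ''B'' [e, r, c] 0 s"
  let ?I = "\<lambda>k s'. same_except {''t''} {''B''} s s' \<and> nats s' ''t'' [] = k \<and>
    reals s' ''B'' = (reals s ''B'')([e, r, c] := - shifted_sum a m \<epsilon> e r c k)"
  show "runs_to (For ''t'' (NGet ''m'' []) entry_step) ?Q (50 * m + 6) s1"
  proof (rule runs_to_For[where I = ?I and n = m and T = 42])
    fix k s' assume k: "k < m" and I: "?I k s'"
    have same: "same_except {''t''} {''B''} s s'" using I by simp
    note fr = same_except_nats[OF same] same_except_reals[OF same]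
    have E: "nats s ''E'' [k] = \<epsilon> k" "0 < \<epsilon> k" and L: "reals s ''L'' [r, k] = a r k"
      using inst k rc by (auto simp: weights_loaded_def)
    \<comment> \<open>Since the weight is positive, the entry lies in a layer strictly below
      \<open>e\<close>: it is final, and it is not the cell being accumulated.\<close>
    have "\<epsilon> k \<le> e \<Longrightarrow> reals s ''B'' [e - \<epsilon> k, k, c] = adj_coeff a m \<epsilon> (e - \<epsilon> k) k c"
      using below E(2) k rc by (auto simp: adj_below_def)
    then show "runs_to entry_step
      (\<lambda>s''. nats s'' ''t'' [] = k \<and> ?I (Suc k) (put_nat ''t'' [] (Suc k) s'')) 42 s'"
      unfolding entry_step_def using I E L idx
      by (intro runs_to_Cond[where T = 34] runs_to_Skip runs_to_SetR)
        (auto simp: fr shifted_sum_def)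
  qed (use s1 inst in \<open>auto simp: shifted_sum_def weights_loaded_def same_except_nats\<close>)
qed (use idx in \<open>auto intro!: runs_to_SetR\<close>)

definition row_prog :: com where
  "row_prog = For ''c'' (NGet ''m'' []) entry_prog"

lemma runs_to_row_prog:
  assumes inst: "weights_loaded a m \<epsilon> s"
    and r: "r < m"
    and idx: "nats s ''e'' [] = e" "nats s ''r'' [] = r"
    and below: "adj_below a m \<epsilon> e (reals s ''B'')"
  shows "runs_to row_prog
    (\<lambda>s'. same_except {''t'', ''c''} {''B''} s s' \<and>
      reals s' ''B'' = (\<lambda>is. if \<exists>c<m. is = [e, r, c] then - shifted_sum a m \<epsilon> e r (is ! 2) m
        else reals s ''B'' is)) (m * (50 * m + 28) + 6) s"
  unfolding row_prog_def
proof (rule runs_to_For[where n = m and T = "50 * m + 20" and I = "\<lambda>k s'.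
    same_except {''t'', ''c''} {''B''} s s' \<and> nats s' ''c'' [] = k \<and>
      reals s' ''B'' = (\<lambda>is. if \<exists>c<k. is = [e, r, c] then - shifted_sum a m \<epsilon> e r (is ! 2) m
        else reals s ''B'' is)"])
  fix k s' assume k: "k < m" and I: "same_except {''t'', ''c''} {''B''} s s' \<and> nats s' ''c'' [] = k \<and>
      reals s' ''B'' = (\<lambda>is. if \<exists>c<k. is = [e, r, c] then - shifted_sum a m \<epsilon> e r (is ! 2) m
        else reals s ''B'' is)"
  have same: "same_except {''t'', ''c''} {''B''} s s'" using I by simp
  note fr = same_except_nats[OF same] same_except_reals[OF same]
  have inst': "weights_loaded a m \<epsilon> s'"
    using inst weights_loaded_cong[OF same] by simp
  have below': "adj_below a m \<epsilon> e (reals s' ''B'')"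
    using below I by (auto simp: adj_below_def)
  show "runs_to entry_prog (\<lambda>s''. nats s'' ''c'' [] = k \<and>
      same_except {''t'', ''c''} {''B''} s (put_nat ''c'' [] (Suc k) s'') \<and>
      nats (put_nat ''c'' [] (Suc k) s'') ''c'' [] = Suc k \<and>
      reals (put_nat ''c'' [] (Suc k) s'') ''B'' = (\<lambda>is. if \<exists>c<Suc k. is = [e, r, c]
        then - shifted_sum a m \<epsilon> e r (is ! 2) m else reals s ''B'' is)) (50 * m + 20) s'"
  proof (rule runs_to_mono[OF runs_to_entry_prog[OF inst' r k _ _ _ below']])
    fix s'' assume Q: "same_except {''t''} {''B''} s' s'' \<and>
      reals s'' ''B'' = (reals s' ''B'')([e, r, k] := - shifted_sum a m \<epsilon> e r k m)"
    then have "same_except {''t'', ''c''} {''B''} s s''" "nats s'' ''c'' = nats s' ''c''"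
      using same_except_trans[OF same, of "{''t''}" "{''B''}" s''] by (auto simp: same_except_nats)
    then show "nats s'' ''c'' [] = k \<and>
      same_except {''t'', ''c''} {''B''} s (put_nat ''c'' [] (Suc k) s'') \<and>
      nats (put_nat ''c'' [] (Suc k) s'') ''c'' [] = Suc k \<and>
      reals (put_nat ''c'' [] (Suc k) s'') ''B'' = (\<lambda>is. if \<exists>c<Suc k. is = [e, r, c]
        then - shifted_sum a m \<epsilon> e r (is ! 2) m else reals s ''B'' is)"
      using Q I by (auto simp: fun_eq_iff less_Suc_eq)
  qed (use idx I in \<open>auto simp: fr\<close>)
qed (use inst in \<open>auto simp: weights_loaded_def same_except_nats\<close>)

definition fill_prog :: com where
  "fill_prog = For ''r'' (NGet ''m'' []) row_prog"

lemma runs_to_fill_prog: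
  assumes inst: "weights_loaded a m \<epsilon> s"
    and idx: "nats s ''e'' [] = e"
    and below: "adj_below a m \<epsilon> e (reals s ''B'')"
  shows "runs_to fill_prog
    (\<lambda>s'. same_except {''t'', ''c'', ''r''} {''B''} s s' \<and>
      reals s' ''B'' = (\<lambda>is. if \<exists>r<m. \<exists>c<m. is = [e, r, c]
        then - shifted_sum a m \<epsilon> e (is ! 1) (is ! 2) m else reals s ''B'' is))
    (m * (m * (50 * m + 28) + 14) + 6) s"
  unfolding fill_prog_def
proof (rule runs_to_For[where n = m and T = "m * (50 * m + 28) + 6" and I = "\<lambda>k s'.
    same_except {''t'', ''c'', ''r''} {''B''} s s' \<and> nats s' ''r'' [] = k \<and>
      reals s' ''B'' = (\<lambda>is. if \<exists>r<k. \<exists>c<m. is = [e, r, c]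
        then - shifted_sum a m \<epsilon> e (is ! 1) (is ! 2) m else reals s ''B'' is)"])
  fix k s' assume k: "k < m" and I: "same_except {''t'', ''c'', ''r''} {''B''} s s' \<and>
      nats s' ''r'' [] = k \<and> reals s' ''B'' = (\<lambda>is. if \<exists>r<k. \<exists>c<m. is = [e, r, c]
        then - shifted_sum a m \<epsilon> e (is ! 1) (is ! 2) m else reals s ''B'' is)"
  have same: "same_except {''t'', ''c'', ''r''} {''B''} s s'" using I by simp
  note fr = same_except_nats[OF same] same_except_reals[OF same]
  have inst': "weights_loaded a m \<epsilon> s'"
    using inst weights_loaded_cong[OF same] by simp
  have below': "adj_below a m \<epsilon> e (reals s' ''B'')"
    using below I by (auto simp: adj_below_def)
  show "runs_to row_prog (\<lambda>s''. nats s'' ''r'' [] = k \<and>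
      same_except {''t'', ''c'', ''r''} {''B''} s (put_nat ''r'' [] (Suc k) s'') \<and>
      nats (put_nat ''r'' [] (Suc k) s'') ''r'' [] = Suc k \<and>
      reals (put_nat ''r'' [] (Suc k) s'') ''B'' = (\<lambda>is. if \<exists>r<Suc k. \<exists>c<m. is = [e, r, c]
        then - shifted_sum a m \<epsilon> e (is ! 1) (is ! 2) m else reals s ''B'' is)) (m * (50 * m + 28) + 6) s'"
  proof (rule runs_to_mono[OF runs_to_row_prog[OF inst' k _ _ below']])
    fix s'' assume Q: "same_except {''t'', ''c''} {''B''} s' s'' \<and>
      reals s'' ''B'' = (\<lambda>is. if \<exists>c<m. is = [e, k, c] then - shifted_sum a m \<epsilon> e k (is ! 2) m
        else reals s' ''B'' is)"
    then have "same_except {''t'', ''c'', ''r''} {''B''} s s''" "nats s'' ''r'' = nats s' ''r''"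
      using same_except_trans[OF same, of "{''t'', ''c''}" "{''B''}" s'']
      by (auto simp: same_except_nats)
    then show "nats s'' ''r'' [] = k \<and>
      same_except {''t'', ''c'', ''r''} {''B''} s (put_nat ''r'' [] (Suc k) s'') \<and>
      nats (put_nat ''r'' [] (Suc k) s'') ''r'' [] = Suc k \<and>
      reals (put_nat ''r'' [] (Suc k) s'') ''B'' = (\<lambda>is. if \<exists>r<Suc k. \<exists>c<m. is = [e, r, c]
        then - shifted_sum a m \<epsilon> e (is ! 1) (is ! 2) m else reals s ''B'' is)"
      using Q I by (auto simp: fun_eq_iff less_Suc_eq)
  qed (use idx I in \<open>auto simp: fr\<close>)
qed (use inst in \<open>auto simp: weights_loaded_def same_except_nats\<close>)

text \<open>Layer \<open>e\<close> of \<open>B\<close> holds \<open>- T_e\<close> at this moment,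
  hence the subtraction. Exponent zero is skipped, since there the trace identity is void and
  \<open>G\<close> keeps its initial value.\<close>

definition trace_prog :: com where
  "trace_prog = Cond (NLess (NLit 0) (NGet ''e'' []))
    (Seq (SetR ''G'' [] (ROfNat (NLit 0)))
      (Seq
        (For ''t'' (NGet ''m'' [])
          (SetR ''G'' [] (RSub (RGet ''G'' []) (RMul (ROfNat (NGet ''E'' [NGet ''t'' []]))
            (RGet ''B'' [NGet ''e'' [], NGet ''t'' [], NGet ''t'' []])))))
        (SetR ''G'' [] (RDiv (RGet ''G'' []) (ROfNat (NGet ''e'' []))))))
    Skip"

lemma runs_to_trace_prog:
  assumes inst: "weights_loaded a m \<epsilon> s"
    and idx: "nats s ''e'' [] = e"
    and diag: "\<And>r. r < m \<Longrightarrow> reals s ''B'' [e, r, r] = - shifted_sum a m \<epsilon> e r r m"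
    and G0: "e = 0 \<Longrightarrow> reals s ''G'' [] = minor_sum a m \<epsilon> 0"
  shows "runs_to trace_prog
    (\<lambda>s'. same_except {''t''} {''G''} s s' \<and> reals s' ''G'' [] = minor_sum a m \<epsilon> e) (30 * m + 50) s"
    (is "runs_to _ ?Q _ _")
  unfolding trace_prog_def
proof (rule runs_to_Cond[where T = "30 * m + 40"])
  assume "tval s (NLess (NLit 0) (NGet ''e'' []))"
  then have e: "0 < e" using idx by simp
  let ?tr = "\<lambda>k. \<Sum>t<k. real (\<epsilon> t) * shifted_sum a m \<epsilon> e t t m"
  \<comment> \<open>By the recursion, determinant coefficient minus diagonal adjugate coefficient is
    the diagonal entry of \<open>T_e\<close>. So the trace identity determines \<open>G_e\<close>
    before \<open>B_e\<close> is known.\<close>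
  have tr: "?tr m = real e * minor_sum a m \<epsilon> e"
    unfolding minor_sum_trace
    by (intro sum.cong refl) (simp add: adj_coeff_rec shifted_sum_def)
  let ?I = "\<lambda>k s'. same_except {''t''} {''G''} s s' \<and> nats s' ''t'' [] = k \<and> reals s' ''G'' [] = ?tr k"
  show "runs_to (Seq (SetR ''G'' [] (ROfNat (NLit 0)))
      (Seq
        (For ''t'' (NGet ''m'' [])
          (SetR ''G'' [] (RSub (RGet ''G'' []) (RMul (ROfNat (NGet ''E'' [NGet ''t'' []]))
            (RGet ''B'' [NGet ''e'' [], NGet ''t'' [], NGet ''t'' []])))))
        (SetR ''G'' [] (RDiv (RGet ''G'' []) (ROfNat (NGet ''e'' []))))))
    ?Q (30 * m + 40) s"
  proof (rule runs_to_Seq[where P = "\<lambda>s'. s' = put_real ''G'' [] 0 s" and U = 10 and V = "30 * m + 30"];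
      (rule runs_to_Seq[where P = "?I m" and U = "30 * m + 10" and V = 20])?)
    fix s1 assume s1: "s1 = put_real ''G'' [] 0 s"
    show "runs_to (For ''t'' (NGet ''m'' [])
          (SetR ''G'' [] (RSub (RGet ''G'' []) (RMul (ROfNat (NGet ''E'' [NGet ''t'' []]))
            (RGet ''B'' [NGet ''e'' [], NGet ''t'' [], NGet ''t'' []]))))) (?I m) (30 * m + 10) s1"
    proof (rule runs_to_For[where I = ?I and n = m and T = 22])
      fix k s' assume k: "k < m" and I: "?I k s'"
      have same: "same_except {''t''} {''G''} s s'" using I by simp
      note fr = same_except_nats[OF same] same_except_reals[OF same]
      show "runs_to (SetR ''G'' [] (RSub (RGet ''G'' []) (RMul (ROfNat (NGet ''E'' [NGet ''t'' []]))
            (RGet ''B'' [NGet ''e'' [], NGet ''t'' [], NGet ''t'' []]))))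
        (\<lambda>s''. nats s'' ''t'' [] = k \<and> ?I (Suc k) (put_nat ''t'' [] (Suc k) s'')) 22 s'"
        using I k idx inst diag by (intro runs_to_SetR) (auto simp: fr weights_loaded_def)
    qed (use s1 inst in \<open>auto simp: weights_loaded_def same_except_nats\<close>)
  next
    fix s2 assume I: "?I m s2"
    then show "runs_to (SetR ''G'' [] (RDiv (RGet ''G'' []) (ROfNat (NGet ''e'' [])))) ?Q 20 s2"
      using tr idx e by (intro runs_to_SetR) (auto simp: same_except_nats)
  qed (auto intro!: runs_to_SetR)
qed (use idx G0 in \<open>auto intro!: runs_to_Skip\<close>)

text \<open>Turns the stored \<open>- T_e\<close> into \<open>B_e = G_e I - T_e\<close>.\<close>

definition diag_prog :: com where
  "diag_prog = For ''t'' (NGet ''m'' [])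
    (SetR ''B'' [NGet ''e'' [], NGet ''t'' [], NGet ''t'' []]
      (RAdd (RGet ''B'' [NGet ''e'' [], NGet ''t'' [], NGet ''t'' []]) (RGet ''G'' [])))"

lemma runs_to_diag_prog:
  assumes m: "nats s ''m'' [] = m"
    and idx: "nats s ''e'' [] = e"
  shows "runs_to diag_prog
    (\<lambda>s'. same_except {''t''} {''B''} s s' \<and>
      reals s' ''B'' = (\<lambda>is. if \<exists>t<m. is = [e, t, t] then reals s ''B'' is + reals s ''G'' []
        else reals s ''B'' is)) (25 * m + 6) s"
  unfolding diag_prog_def
proof (rule runs_to_For[where n = m and T = 17 and I = "\<lambda>k s'.
    same_except {''t''} {''B''} s s' \<and> nats s' ''t'' [] = k \<and>
      reals s' ''B'' = (\<lambda>is. if \<exists>t<k. is = [e, t, t] then reals s ''B'' is + reals s ''G'' []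
        else reals s ''B'' is)"])
  fix k s' assume k: "k < m" and I: "same_except {''t''} {''B''} s s' \<and> nats s' ''t'' [] = k \<and>
      reals s' ''B'' = (\<lambda>is. if \<exists>t<k. is = [e, t, t] then reals s ''B'' is + reals s ''G'' []
        else reals s ''B'' is)"
  have same: "same_except {''t''} {''B''} s s'" using I by simp
  note fr = same_except_nats[OF same] same_except_reals[OF same]
  show "runs_to (SetR ''B'' [NGet ''e'' [], NGet ''t'' [], NGet ''t'' []]
      (RAdd (RGet ''B'' [NGet ''e'' [], NGet ''t'' [], NGet ''t'' []]) (RGet ''G'' [])))
    (\<lambda>s''. nats s'' ''t'' [] = k \<and>
      same_except {''t''} {''B''} s (put_nat ''t'' [] (Suc k) s'') \<and>
      nats (put_nat ''t'' [] (Suc k) s'') ''t'' [] = Suc k \<and>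
      reals (put_nat ''t'' [] (Suc k) s'') ''B'' = (\<lambda>is. if \<exists>t<Suc k. is = [e, t, t]
        then reals s ''B'' is + reals s ''G'' [] else reals s ''B'' is)) 17 s'"
    using I k idx by (intro runs_to_SetR) (auto simp: fr fun_eq_iff less_Suc_eq)
qed (use m in \<open>auto simp: same_except_nats\<close>)

definition coeff_prog :: com where
  "coeff_prog = Seq (SetR ''G'' [] (ROfNat (NLit 1)))
    (For ''e'' (NAdd (NGet ''K'' []) (NLit 1)) (Seq fill_prog (Seq trace_prog diag_prog)))"

definition step_time :: "nat \<Rightarrow> nat" where
  "step_time m = m * (m * (50 * m + 28) + 14) + 6 + (30 * m + 50) + (25 * m + 6)"

lemma runs_to_coeff_prog:
  assumes inst: "weights_loaded a m \<epsilon> s" and K: "nats s ''K'' [] = K"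
  shows "runs_to coeff_prog
    (\<lambda>s'. same_except {''t'', ''c'', ''r'', ''e''} {''B'', ''G''} s s' \<and>
      reals s' ''G'' [] = minor_sum a m \<epsilon> K) ((K + 1) * (step_time m + 10) + 12) s"
    (is "runs_to _ ?Q _ _")
  unfolding coeff_prog_def
proof (rule runs_to_Seq[where P = "\<lambda>s'. s' = put_real ''G'' [] 1 s" and U = 4
      and V = "(K + 1) * (step_time m + 10) + 8"])
  fix s1 assume s1: "s1 = put_real ''G'' [] 1 s"
  let ?same = "same_except {''t'', ''c'', ''r'', ''e''} {''B'', ''G''} s"
  \<comment> \<open>The last finished exponent is \<open>k - 1\<close>. Truncated subtraction makes
    the invariant at \<open>k = 0\<close> speak of exponent zero, whose coefficient is the initial
    value 1 of \<open>G\<close>.\<close>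
  let ?I = "\<lambda>k s'. ?same s' \<and> nats s' ''e'' [] = k \<and> adj_below a m \<epsilon> k (reals s' ''B'') \<and>
    reals s' ''G'' [] = minor_sum a m \<epsilon> (k - 1)"
  show "runs_to (For ''e'' (NAdd (NGet ''K'' []) (NLit 1)) (Seq fill_prog (Seq trace_prog diag_prog)))
      ?Q ((K + 1) * (step_time m + 10) + 8) s1"
  proof (rule runs_to_For[where I = ?I and n = "K + 1" and T = "step_time m"])
    fix k s' assume I: "?I k s'"
    have same: "?same s'" using I by simp
    note fr = same_except_nats[OF same] same_except_reals[OF same]
    have inst': "weights_loaded a m \<epsilon> s'"
      using inst weights_loaded_cong[OF same] by simp
    show "runs_to (Seq fill_prog (Seq trace_prog diag_prog))
      (\<lambda>s''. nats s'' ''e'' [] = k \<and> ?I (Suc k) (put_nat ''e'' [] (Suc k) s'')) (step_time m) s'"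
      (is "runs_to _ ?Q' _ _")
    proof (rule runs_to_Seq[OF runs_to_fill_prog[OF inst', where e = k]])
      fix s2 assume s2: "same_except {''t'', ''c'', ''r''} {''B''} s' s2 \<and>
        reals s2 ''B'' = (\<lambda>is. if \<exists>r<m. \<exists>c<m. is = [k, r, c]
          then - shifted_sum a m \<epsilon> k (is ! 1) (is ! 2) m else reals s' ''B'' is)"
      then have same2: "same_except {''t'', ''c'', ''r''} {''B''} s' s2" by simp
      note fr2 = same_except_nats[OF same2] same_except_reals[OF same2]
      have inst2: "weights_loaded a m \<epsilon> s2"
        using inst' weights_loaded_cong[OF same2] by simp
      show "runs_to (Seq trace_prog diag_prog) ?Q' ((30 * m + 50) + (25 * m + 6)) s2"
      proof (rule runs_to_Seq[OF runs_to_trace_prog[OF inst2, where e = k]])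
        fix s3 assume s3: "same_except {''t''} {''G''} s2 s3 \<and> reals s3 ''G'' [] = minor_sum a m \<epsilon> k"
        then have same3: "same_except {''t''} {''G''} s2 s3" by simp
        note fr3 = same_except_nats[OF same3] same_except_reals[OF same3]
        have inst3: "weights_loaded a m \<epsilon> s3"
          using inst2 weights_loaded_cong[OF same3] by simp
        show "runs_to diag_prog ?Q' (25 * m + 6) s3"
        proof (rule runs_to_mono[OF runs_to_diag_prog[where e = k and m = m]])
          fix s4 assume s4: "same_except {''t''} {''B''} s3 s4 \<and>
            reals s4 ''B'' = (\<lambda>is. if \<exists>t<m. is = [k, t, t] then reals s3 ''B'' is + reals s3 ''G'' []
              else reals s3 ''B'' is)"
          then have same4: "same_except {''t''} {''B''} s3 s4" by simp
          have "same_except {''t'', ''c'', ''r'', ''e''} {''B'', ''G''} s s3"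
            by (rule same_except_trans[OF same_except_trans[OF same same2 order.refl _ order.refl] same3]) auto
          then have "?same s4"
            by (rule same_except_trans[OF _ same4]) auto
          moreover have "adj_below a m \<epsilon> (Suc k) (reals s4 ''B'')"
            using I s2 s3 s4 adj_coeff_rec[of _ m _ a \<epsilon> k]
            by (auto simp: adj_below_def less_Suc_eq fr3 shifted_sum_def)
          ultimately show "?Q' s4"
            using I s3 by (auto simp: fr2 fr3 same_except_nats[OF same4] same_except_reals[OF same4])
        qed (use inst3 I in \<open>auto simp: weights_loaded_def fr2 fr3\<close>)
      qed (use I s2 in \<open>auto simp: fr2\<close>)
    qed (use I in \<open>auto simp: step_time_def\<close>)
  qed (use s1 K inst in \<open>auto simp: adj_below_def same_except_nats minor_sum_zero weights_loaded_def\<close>)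
qed (auto intro!: runs_to_SetR)

section \<open>The sampling program\<close>

definition problem_loaded ::
    "nat \<Rightarrow> nat \<Rightarrow> (nat \<Rightarrow> nat set) \<Rightarrow> (nat \<Rightarrow> nat) \<Rightarrow> state \<Rightarrow> bool" where
  "problem_loaded m p P b s \<longleftrightarrow> nats s ''m'' [] = m \<and> nats s ''p'' [] = p \<and>
    (\<forall>j<p. \<forall>x. nats s ''P'' [j, x] = (if x \<in> P j then 1 else 0)) \<and>
    (\<forall>j<p. nats s ''b'' [j] = b j)"

lemma problem_loaded_cong:
  "same_except X R s s' \<Longrightarrow> {''m'', ''p'', ''P'', ''b''} \<inter> X = {} \<Longrightarrow>
    problem_loaded m p P b s' = problem_loaded m p P b s"
  by (simp add: problem_loaded_def same_except_nats)

definition powers_loaded :: "nat \<Rightarrow> nat \<Rightarrow> state \<Rightarrow> bool" where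
  "powers_loaded m p s \<longleftrightarrow> (\<forall>l\<le>p + 1. nats s ''W'' [l] = (m + 1) ^ l)"

lemma powers_loaded_cong:
  "same_except X R s s' \<Longrightarrow> ''W'' \<notin> X \<Longrightarrow> powers_loaded m p s' = powers_loaded m p s"
  by (simp add: powers_loaded_def same_except_nats)

text \<open>Indices can only be added, so each power is obtained by adding the previous one
  \<open>m + 1\<close> times to a cell that is initially zero.\<close>

definition power_step :: com where
  "power_step = SetN ''W'' [NAdd (NGet ''j'' []) (NLit 1)]
    (NAdd (NGet ''W'' [NAdd (NGet ''j'' []) (NLit 1)]) (NGet ''W'' [NGet ''j'' []]))"

definition power_prog :: com where
  "power_prog = Seq (SetN ''W'' [NLit 0] (NLit 1))
    (For ''j'' (NAdd (NGet ''p'' []) (NLit 1)) (For ''t'' (NAdd (NGet ''m'' []) (NLit 1)) power_step))"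

lemma runs_to_power_prog:
  assumes inst: "problem_loaded m p P b s" and zero: "nats s ''W'' = (\<lambda>_. 0)"
  shows "runs_to power_prog
    (\<lambda>s'. same_except {''W'', ''j'', ''t''} {} s s' \<and> powers_loaded m p s')
    ((p + 1) * ((m + 1) * 25 + 20) + 20) s" (is "runs_to _ ?Q _ _")
  unfolding power_prog_def
proof (rule runs_to_Seq[where P = "\<lambda>s'. s' = put_nat ''W'' [0] 1 s" and U = 5
      and V = "(p + 1) * ((m + 1) * 25 + 20) + 10"])
  fix s1 assume s1: "s1 = put_nat ''W'' [0] 1 s"
  let ?same = "same_except {''W'', ''j'', ''t''} {} s"
  let ?I = "\<lambda>k s'. ?same s' \<and> nats s' ''j'' [] = k \<and>
    (\<forall>l. nats s' ''W'' [l] = (if l \<le> k then (m + 1) ^ l else 0))"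
  show "runs_to (For ''j'' (NAdd (NGet ''p'' []) (NLit 1))
      (For ''t'' (NAdd (NGet ''m'' []) (NLit 1)) power_step)) ?Q
      ((p + 1) * ((m + 1) * 25 + 20) + 10) s1"
  proof (rule runs_to_For[where I = ?I and n = "p + 1" and T = "(m + 1) * 25 + 10"])
    fix k s2 assume I: "?I k s2"
    let ?J = "\<lambda>u s'. ?same s' \<and> nats s' ''t'' [] = u \<and> nats s' ''j'' [] = k \<and>
      (\<forall>l. nats s' ''W'' [l] = (if l \<le> k then (m + 1) ^ l else if l = Suc k then u * (m + 1) ^ k else 0))"
    show "runs_to (For ''t'' (NAdd (NGet ''m'' []) (NLit 1)) power_step)
      (\<lambda>s''. nats s'' ''j'' [] = k \<and> ?I (Suc k) (put_nat ''j'' [] (Suc k) s'')) ((m + 1) * 25 + 10) s2"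
    proof (rule runs_to_For[where I = ?J and n = "m + 1" and T = 11])
      fix u s3 assume J: "?J u s3"
      then show "runs_to power_step
        (\<lambda>s''. nats s'' ''t'' [] = u \<and> ?J (Suc u) (put_nat ''t'' [] (Suc u) s'')) 11 s3"
        unfolding power_step_def by (intro runs_to_SetN) auto
    qed (use I inst in \<open>auto simp: problem_loaded_def same_except_nats le_Suc_eq\<close>)
  qed (use s1 inst zero in \<open>auto simp: problem_loaded_def powers_loaded_def same_except_nats\<close>)
qed (auto intro!: runs_to_SetN)

definition weight_step :: com where
  "weight_step = Cond (NLess (NLit 0) (NGet ''P'' [NGet ''j'' [], NGet ''t'' []]))
    (SetN ''E'' [NGet ''t'' []] (NAdd (NGet ''E'' [NGet ''t'' []]) (NGet ''W'' [NGet ''j'' []])))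
    Skip"

definition weight_prog :: com where
  "weight_prog = For ''j'' (NGet ''p'' []) (For ''t'' (NGet ''m'' []) weight_step)"

lemma runs_to_weight_prog:
  assumes inst: "problem_loaded m p P b s" and W: "powers_loaded m p s"
    and zero: "nats s ''E'' = (\<lambda>_. 0)"
  shows "runs_to weight_prog
    (\<lambda>s'. same_except {''E'', ''j'', ''t''} {} s s' \<and> (\<forall>x<m. nats s' ''E'' [x] = base_weight m p P x))
    (p * (20 + m * 30) + 10) s" (is "runs_to _ ?Q _ _")
proof -
  let ?same = "same_except {''E'', ''j'', ''t''} {} s"
  let ?I = "\<lambda>k s'. ?same s' \<and> nats s' ''j'' [] = k \<and>
    (\<forall>x<m. nats s' ''E'' [x] = base_weight m k P x)"
  show ?thesis
    unfolding weight_prog_def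
  proof (rule runs_to_For[where I = ?I and n = p and T = "m * 30 + 12"])
    fix k s2 assume k: "k < p" and I: "?I k s2"
    let ?J = "\<lambda>u s'. ?same s' \<and> nats s' ''t'' [] = u \<and> nats s' ''j'' [] = k \<and>
      (\<forall>x<m. nats s' ''E'' [x] = base_weight m k P x + (if x < u \<and> x \<in> P k then (m + 1) ^ k else 0))"
    show "runs_to (For ''t'' (NGet ''m'' []) weight_step)
      (\<lambda>s''. nats s'' ''j'' [] = k \<and> ?I (Suc k) (put_nat ''j'' [] (Suc k) s'')) (m * 30 + 12) s2"
    proof (rule runs_to_For[where I = ?J and n = m and T = 20])
      fix u s3 assume u: "u < m" and J: "?J u s3"
      have same: "?same s3" using J by simp
      note fr = same_except_nats[OF same]
      have "nats s ''P'' [k, u] = (if u \<in> P k then 1 else 0)" "nats s ''W'' [k] = (m + 1) ^ k"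
        using inst W k by (auto simp: problem_loaded_def powers_loaded_def)
      then show "runs_to weight_step
        (\<lambda>s''. nats s'' ''t'' [] = u \<and> ?J (Suc u) (put_nat ''t'' [] (Suc u) s'')) 20 s3"
        unfolding weight_step_def using J u
        by (intro runs_to_Cond[where T = 12] runs_to_SetN runs_to_Skip)
          (auto simp: fr less_Suc_eq split: if_splits)
    qed (use I inst in \<open>auto simp: problem_loaded_def same_except_nats base_weight_def\<close>)
  qed (use inst zero in \<open>auto simp: problem_loaded_def same_except_nats base_weight_def\<close>)
qed

definition target_step :: com where
  "target_step = SetN ''K'' [] (NAdd (NGet ''K'' []) (NGet ''W'' [NGet ''j'' []]))"

definition target_prog :: com where
  "target_prog = For ''j'' (NGet ''p'' []) (For ''t'' (NGet ''b'' [NGet ''j'' []]) target_step)"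

lemma runs_to_target_prog:
  assumes inst: "problem_loaded m p P b s" and W: "powers_loaded m p s"
    and zero: "nats s ''K'' [] = 0" and b: "\<And>j. j < p \<Longrightarrow> b j \<le> m"
  shows "runs_to target_prog
    (\<lambda>s'. same_except {''K'', ''j'', ''t''} {} s s' \<and> nats s' ''K'' [] = target_weight m p b)
    (p * (20 + m * 20) + 10) s" (is "runs_to _ ?Q _ _")
proof -
  let ?same = "same_except {''K'', ''j'', ''t''} {} s"
  let ?I = "\<lambda>k s'. ?same s' \<and> nats s' ''j'' [] = k \<and> nats s' ''K'' [] = target_weight m k b"
  show ?thesis
    unfolding target_prog_def
  proof (rule runs_to_For[where I = ?I and n = p and T = "m * 20 + 12"])
    fix k s2 assume k: "k < p" and I: "?I k s2"
    let ?J = "\<lambda>u s'. ?same s' \<and> nats s' ''t'' [] = u \<and> nats s' ''j'' [] = k \<and>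
      nats s' ''K'' [] = target_weight m k b + u * (m + 1) ^ k"
    show "runs_to (For ''t'' (NGet ''b'' [NGet ''j'' []]) target_step)
      (\<lambda>s''. nats s'' ''j'' [] = k \<and> ?I (Suc k) (put_nat ''j'' [] (Suc k) s'')) (m * 20 + 12) s2"
    proof (rule runs_to_For[where I = ?J and n = "b k" and T = 10])
      fix u s3 assume J: "?J u s3"
      have same: "?same s3" using J by simp
      note fr = same_except_nats[OF same]
      show "runs_to target_step
        (\<lambda>s''. nats s'' ''t'' [] = u \<and> ?J (Suc u) (put_nat ''t'' [] (Suc u) s'')) 10 s3"
        unfolding target_step_def using J W k
        by (intro runs_to_SetN) (auto simp: fr powers_loaded_def)
    next
      show "b k * (10 + 7 + ncost (NGet ''b'' [NGet ''j'' []])) + 5 + ncost (NGet ''b'' [NGet ''j'' []])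
          \<le> m * 20 + 12"
        using mult_right_mono[OF b[OF k], of 19] by simp
    qed (use I inst k in \<open>auto simp: problem_loaded_def same_except_nats target_weight_def\<close>)
  qed (use inst zero in \<open>auto simp: problem_loaded_def same_except_nats target_weight_def\<close>)
qed

definition prepare_prog :: com where
  "prepare_prog = Seq power_prog (Seq weight_prog target_prog)"

definition prepare_time :: "nat \<Rightarrow> nat \<Rightarrow> nat" where
  "prepare_time m p = ((p + 1) * ((m + 1) * 25 + 20) + 20) +
    ((p * (20 + m * 30) + 10) + (p * (20 + m * 20) + 10))"

text \<open>The memory already encodes the condition imposed by the first \<open>i\<close>
  decisions; a further decision changes at most one weight and the target.\<close>

definition main_inv ::
    "nat \<Rightarrow> nat \<Rightarrow> (nat \<Rightarrow> nat set) \<Rightarrow> (nat \<Rightarrow> nat) \<Rightarrow> real mat \<Rightarrow> nat \<Rightarrow> nat set \<Rightarrow> state \<Rightarrow> bool" where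
  "main_inv m p P b L i A s \<longleftrightarrow> nats s ''p'' [] = p \<and> powers_loaded m p s \<and>
    weights_loaded (\<lambda>i j. L $$ (i, j)) m (cond_weight m p P i A) s \<and>
    nats s ''K'' [] = target_weight m p b + card A * (m + 1) ^ p \<and>
    nats s ''i'' [] = i \<and> (\<forall>x<m. nats s ''S'' [x] \<noteq> 0 \<longleftrightarrow> x \<in> A)"

lemma runs_to_prepare_prog:
  assumes pd: "partition_data m p P b" and s: "s = input m L p P b"
  shows "runs_to prepare_prog (main_inv m p P b L 0 {}) (prepare_time m p) s"
proof -
  have inst: "problem_loaded m p P b s"
    by (auto simp: s problem_loaded_def input_def)
  have zero: "nats s ''W'' = (\<lambda>_. 0)" "nats s ''E'' = (\<lambda>_. 0)" "nats s ''K'' [] = 0"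
    by (auto simp: s input_def fun_eq_iff split: list.splits)
  show ?thesis
    unfolding prepare_prog_def prepare_time_def
  proof (rule runs_to_Seq[OF runs_to_power_prog[OF inst zero(1)]])
    fix s1 assume "same_except {''W'', ''j'', ''t''} {} s s1 \<and> powers_loaded m p s1"
    then have same1: "same_except {''W'', ''j'', ''t''} {} s s1" and W: "powers_loaded m p s1" by auto
    note fr1 = same_except_nats[OF same1] same_except_reals[OF same1]
    have inst1: "problem_loaded m p P b s1"
      using inst problem_loaded_cong[OF same1] by simp
    show "runs_to (Seq weight_prog target_prog) (main_inv m p P b L 0 {})
      ((p * (20 + m * 30) + 10) + (p * (20 + m * 20) + 10)) s1"
    proof (rule runs_to_Seq[OF runs_to_weight_prog[OF inst1 W]])
      fix s2 assume s2: "same_except {''E'', ''j'', ''t''} {} s1 s2 \<and>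
        (\<forall>x<m. nats s2 ''E'' [x] = base_weight m p P x)"
      then have same2: "same_except {''E'', ''j'', ''t''} {} s1 s2" by auto
      note fr2 = same_except_nats[OF same2] same_except_reals[OF same2]
      have inst2: "problem_loaded m p P b s2" and W2: "powers_loaded m p s2"
        using inst1 W problem_loaded_cong[OF same2] powers_loaded_cong[OF same2] by auto
      show "runs_to target_prog (main_inv m p P b L 0 {}) (p * (20 + m * 20) + 10) s2"
      proof (rule runs_to_mono[OF runs_to_target_prog[OF inst2 W2]])
        fix s3 assume s3: "same_except {''K'', ''j'', ''t''} {} s2 s3 \<and>
          nats s3 ''K'' [] = target_weight m p b"
        then have same3: "same_except {''K'', ''j'', ''t''} {} s2 s3" by auto
        note fr3 = same_except_nats[OF same3] same_except_reals[OF same3]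
        have "powers_loaded m p s3" using W2 powers_loaded_cong[OF same3] by simp
        moreover have "cond_weight m p P 0 {} = base_weight m p P"
          by (simp add: cond_weight_def fun_eq_iff)
        ultimately show "main_inv m p P b L 0 {} s3"
          using s2 s3 base_weight_pos[OF pd]
          by (auto simp: main_inv_def weights_loaded_def fr1 fr2 fr3 s input_def)
      qed (use zero partition_data_le(3)[OF pd] in \<open>auto simp: fr1 fr2\<close>)
    qed (use zero in \<open>auto simp: fr1\<close>)
  qed simp
qed

section \<open>Deciding one element\<close>

definition trial_prog :: com where
  "trial_prog =
    Seq (SetN ''e0'' [] (NGet ''E'' [NGet ''i'' []]))
   (Seq (SetN ''K0'' [] (NGet ''K'' []))
   (Seq (SetN ''E'' [NGet ''i'' []] (NGet ''W'' [NAdd (NGet ''p'' []) (NLit 1)]))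
   (Seq coeff_prog
   (Seq (SetR ''z0'' [] (RGet ''G'' []))
   (Seq (SetN ''E'' [NGet ''i'' []] (NAdd (NGet ''e0'' []) (NGet ''W'' [NGet ''p'' []])))
   (Seq (SetN ''K'' [] (NAdd (NGet ''K0'' []) (NGet ''W'' [NGet ''p'' []])))
   (Seq coeff_prog
        (SetR ''z1'' [] (RGet ''G'' [])))))))))"

definition trial_post ::
    "nat \<Rightarrow> nat \<Rightarrow> (nat \<Rightarrow> nat set) \<Rightarrow> (nat \<Rightarrow> nat) \<Rightarrow> real mat \<Rightarrow> nat \<Rightarrow> nat set \<Rightarrow> state \<Rightarrow> bool" where
  "trial_post m p P b L i A s \<longleftrightarrow> nats s ''p'' [] = p \<and> powers_loaded m p s \<and>
    weights_loaded (\<lambda>i j. L $$ (i, j)) m (cond_weight m p P (Suc i) (insert i A)) s \<and>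
    nats s ''K'' [] = target_weight m p b + card (insert i A) * (m + 1) ^ p \<and>
    nats s ''K0'' [] = target_weight m p b + card A * (m + 1) ^ p \<and>
    nats s ''i'' [] = i \<and> (\<forall>x<m. nats s ''S'' [x] \<noteq> 0 \<longleftrightarrow> x \<in> A) \<and>
    reals s ''z0'' [] = cond_mass L (partition_family m p P b) (Suc i) A \<and>
    reals s ''z1'' [] = cond_mass L (partition_family m p P b) (Suc i) (insert i A)"

definition coeff_time :: "nat \<Rightarrow> nat \<Rightarrow> nat" where
  "coeff_time m p = (m + 1) ^ (p + 1) * (step_time m + 10) + 12"

lemma runs_to_SetN_Seq:
  "runs_to d Q V (put_nat x (map (nval s) is) (nval s a) s) \<Longrightarrow>
    1 + sum_list (map ncost is) + ncost a + V \<le> T \<Longrightarrow> runs_to (Seq (SetN x is a) d) Q T s"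
  by (rule runs_to_Seq[where P = "\<lambda>s'. s' = put_nat x (map (nval s) is) (nval s a) s",
        OF runs_to_SetN[OF refl order.refl]]) auto

lemma runs_to_SetR_Seq:
  "runs_to d Q V (put_real x (map (nval s) is) (rval s e) s) \<Longrightarrow>
    1 + sum_list (map ncost is) + rcost e + V \<le> T \<Longrightarrow> runs_to (Seq (SetR x is e) d) Q T s"
  by (rule runs_to_Seq[where P = "\<lambda>s'. s' = put_real x (map (nval s) is) (rval s e) s",
        OF runs_to_SetR[OF refl order.refl]]) auto

lemma runs_to_coeff_prog_cond_mass:
  assumes L: "L \<in> carrier_mat m m" and pd: "partition_data m p P b"
    and i: "i \<le> m" and A: "A \<subseteq> {0..<i}"
    and inst: "weights_loaded (\<lambda>i j. L $$ (i, j)) m (cond_weight m p P i A) s"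
    and K: "nats s ''K'' [] = target_weight m p b + card A * (m + 1) ^ p"
  shows "runs_to coeff_prog
    (\<lambda>s'. same_except {''t'', ''c'', ''r'', ''e''} {''B'', ''G''} s s' \<and>
      reals s' ''G'' [] = cond_mass L (partition_family m p P b) i A) (coeff_time m p) s"
proof -
  have "A \<subseteq> {0..<m}" using A i by auto
  then have "nats s ''K'' [] + 1 \<le> (m + 1) ^ (p + 1)"
    using target_weight_less[OF pd, of A] K by simp
  then have "(nats s ''K'' [] + 1) * (step_time m + 10) \<le> (m + 1) ^ (p + 1) * (step_time m + 10)"
    by (rule mult_right_mono) simp
  then show ?thesis
    using K minor_sum_cond_weight[OF L pd i A]
    by (intro runs_to_mono[OF runs_to_coeff_prog[OF inst refl]]) (simp_all add: coeff_time_def)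
qed

text \<open>Both decisions on \<open>i\<close> are tried: rejection gives \<open>i\<close> the
  prohibitive weight and keeps the target, acceptance raises weight and target by
  \<open>(m + 1) ^ p\<close>. The cells \<open>e0\<close> and \<open>K0\<close> preserve the old
  values, and the encoding of acceptance is left in memory.\<close>

lemma runs_to_trial_prog:
  assumes L: "L \<in> carrier_mat m m" and pd: "partition_data m p P b"
    and i: "i < m" and A: "A \<subseteq> {0..<i}" and inv: "main_inv m p P b L i A s"
  shows "runs_to trial_prog (trial_post m p P b L i A) (2 * coeff_time m p + 50) s"
proof -
  let ?a = "\<lambda>i j. L $$ (i, j)"
  let ?D = "(m + 1) ^ p"
  let ?K = "target_weight m p b + card A * ?D"
  let ?same = "same_except {''t'', ''c'', ''r'', ''e''} {''B'', ''G''}"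
  have W: "nats s ''W'' [p] = ?D" "nats s ''W'' [p + 1] = (m + 1) ^ (p + 1)"
    using inv by (auto simp: main_inv_def powers_loaded_def)
  have iA: "i \<notin> A" and fA: "finite A" using A finite_subset by auto
  have E: "\<forall>x<m. nats s ''E'' [x] = cond_weight m p P i A x" and Ei: "nats s ''E'' [i] = base_weight m p P i"
    using inv i by (auto simp: main_inv_def weights_loaded_def cond_weight_def)
  \<comment> \<open>Relative to the current encoding, either decision alters the weight of
    \<open>i\<close> only.\<close>
  have excl: "cond_weight m p P (Suc i) A x = (if x = i then (m + 1) ^ (p + 1) else cond_weight m p P i A x)" for x
    using iA by (auto simp: cond_weight_def)
  have incl: "cond_weight m p P (Suc i) (insert i A) x =
      (if x = i then base_weight m p P i + ?D else cond_weight m p P i A x)" for x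
    by (auto simp: cond_weight_def)
  define s1 where "s1 = put_nat ''E'' [i] ((m + 1) ^ (p + 1)) (put_nat ''K0'' [] ?K
    (put_nat ''e0'' [] (base_weight m p P i) s))"
  have inst1: "weights_loaded ?a m (cond_weight m p P (Suc i) A) s1"
    using inv cond_weight_pos[OF pd] by (auto simp: main_inv_def weights_loaded_def s1_def excl)
  have K1: "nats s1 ''K'' [] = ?K"
    using inv by (simp add: s1_def main_inv_def)
  let ?rest2 = "Seq coeff_prog (SetR ''z1'' [] (RGet ''G'' []))"
  let ?rest1 = "Seq (SetR ''z0'' [] (RGet ''G'' []))
   (Seq (SetN ''E'' [NGet ''i'' []] (NAdd (NGet ''e0'' []) (NGet ''W'' [NGet ''p'' []])))
   (Seq (SetN ''K'' [] (NAdd (NGet ''K0'' []) (NGet ''W'' [NGet ''p'' []]))) ?rest2))"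
  have "runs_to (Seq coeff_prog ?rest1) (trial_post m p P b L i A) (2 * coeff_time m p + 35) s1"
  proof (rule runs_to_Seq[OF runs_to_coeff_prog_cond_mass[OF L pd _ _ inst1 K1]])
    fix s2 assume s2: "?same s1 s2 \<and> reals s2 ''G'' [] = cond_mass L (partition_family m p P b) (Suc i) A"
    then have same2: "?same s1 s2" by simp
    note fr2 = same_except_nats[OF same2] same_except_reals[OF same2]
    define s3 where "s3 = put_nat ''K'' [] (?K + ?D) (put_nat ''E'' [i] (base_weight m p P i + ?D)
      (put_real ''z0'' [] (reals s2 ''G'' []) s2))"
    have inst3: "weights_loaded ?a m (cond_weight m p P (Suc i) (insert i A)) s3"
      using inv cond_weight_pos[OF pd]
      by (auto simp: main_inv_def weights_loaded_def s1_def s3_def incl fr2)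
    have K3: "nats s3 ''K'' [] = target_weight m p b + card (insert i A) * ?D"
      using iA fA by (simp add: s3_def)
    have "runs_to ?rest2 (trial_post m p P b L i A) (coeff_time m p + 3) s3"
    proof (rule runs_to_Seq[OF runs_to_coeff_prog_cond_mass[OF L pd _ _ inst3 K3]])
      fix s4 assume s4: "?same s3 s4 \<and>
        reals s4 ''G'' [] = cond_mass L (partition_family m p P b) (Suc i) (insert i A)"
      then have same4: "?same s3 s4" by simp
      note fr4 = same_except_nats[OF same4] same_except_reals[OF same4]
      show "runs_to (SetR ''z1'' [] (RGet ''G'' [])) (trial_post m p P b L i A) 3 s4"
        using s2 s4 inst3 K3 inv
        by (intro runs_to_SetR) (auto simp: trial_post_def main_inv_def powers_loaded_def
            weights_loaded_def fr4 fr2 s3_def s1_def)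
    qed (use i A in auto)
    then show "runs_to ?rest1 (trial_post m p P b L i A) (coeff_time m p + 35) s2"
      using inv W
      by (intro runs_to_SetR_Seq[where V = "coeff_time m p + 30"]
          runs_to_SetN_Seq[where V = "coeff_time m p + 15"] runs_to_SetN_Seq[where V = "coeff_time m p + 3"])
        (auto simp: s3_def fr2 s1_def main_inv_def)
  qed (use i A in auto)
  then show ?thesis
    unfolding trial_prog_def using inv W Ei
    by (intro runs_to_SetN_Seq[where V = "2 * coeff_time m p + 45"]
        runs_to_SetN_Seq[where V = "2 * coeff_time m p + 42"]
        runs_to_SetN_Seq[where V = "2 * coeff_time m p + 35"])
      (auto simp: s1_def main_inv_def)
qed

text \<open>The trial ended with the encoding of acceptance, so only a rejection requires
  repair.\<close>

definition settle_prog :: com where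
  "settle_prog = Seq
    (Cond (NLess (NLit 0) (NGet ''S'' [NGet ''i'' []]))
      Skip
      (Seq (SetN ''E'' [NGet ''i'' []] (NGet ''W'' [NAdd (NGet ''p'' []) (NLit 1)]))
           (SetN ''K'' [] (NGet ''K0'' []))))
    (SetN ''i'' [] (NAdd (NGet ''i'' []) (NLit 1)))"

lemma runs_to_settle_prog:
  assumes pd: "partition_data m p P b"
    and i: "i < m" and A: "A \<subseteq> {0..<i}" and post: "trial_post m p P b L i A s"
  shows "runs_to settle_prog (main_inv m p P b L (Suc i) (insert i A)) 40 (put_nat ''S'' [i] 1 s)"
    and "runs_to settle_prog (main_inv m p P b L (Suc i) A) 40 (put_nat ''S'' [i] 0 s)"
proof -
  have iA: "i \<notin> A" using A by auto
  have excl: "cond_weight m p P (Suc i) A x =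
      (if x = i then (m + 1) ^ (p + 1) else cond_weight m p P (Suc i) (insert i A) x)" for x
    using iA by (auto simp: cond_weight_def)
  show "runs_to settle_prog (main_inv m p P b L (Suc i) (insert i A)) 40 (put_nat ''S'' [i] 1 s)"
    unfolding settle_prog_def
    by (rule runs_to_Seq[where P = "\<lambda>s'. s' = put_nat ''S'' [i] 1 s" and U = 30 and V = 10];
        (rule runs_to_Cond[where T = 1] runs_to_SetN)?)
      (use post in \<open>auto intro!: runs_to_Skip
        simp: trial_post_def main_inv_def powers_loaded_def weights_loaded_def\<close>)
  show "runs_to settle_prog (main_inv m p P b L (Suc i) A) 40 (put_nat ''S'' [i] 0 s)"
    unfolding settle_prog_def
    by (rule runs_to_Seq[where P = "\<lambda>s'. s' = put_nat ''K'' [] (nats s ''K0'' [])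
          (put_nat ''E'' [i] (nats s ''W'' [p + 1]) (put_nat ''S'' [i] 0 s))" and U = 30 and V = 10];
        (rule runs_to_Cond[where T = 20] runs_to_SetN)?)
      (use post iA in \<open>auto intro!: runs_to_SetN_Seq[where V = 5] runs_to_SetN
        simp: trial_post_def main_inv_def powers_loaded_def weights_loaded_def excl\<close>)
qed

section \<open>The sampling loop and its output law\<close>

definition round_prog :: com where
  "round_prog = Seq trial_prog
    (Seq (Toss ''S'' [NGet ''i'' []] (RDiv (RGet ''z1'' []) (RAdd (RGet ''z0'' []) (RGet ''z1'' []))))
      settle_prog)"

definition loop_prog :: com where
  "loop_prog = While (NLess (NGet ''i'' []) (NGet ''m'' [])) round_prog"

text \<open>Induction downwards from \<open>i = m\<close>, mixing the laws of the two branches by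
  the chain rule. Positive mass is carried along as a hypothesis: it makes the bias meaningful, and
  it survives because the coin never enters a branch of mass zero.\<close>

lemma samples_within_loop_prog:
  fixes L :: "real mat"
  assumes L: "psd m L" and pd: "partition_data m p P b"
  defines "C \<equiv> partition_family m p P b"
  assumes "i \<le> m" "A \<subseteq> {0..<i}" "main_inv m p P b L i A s" "0 < cond_mass L C i A"
  shows "samples_within loop_prog s (selected m) C (cond_prob L C i A)
    ((m - i) * (2 * coeff_time m p + 110) + 4)"
  using assms(4-)
proof (induction i arbitrary: A s rule: inc_induct)
  case base
  have sel: "selected m s = A"
    using base.prems by (auto simp: selected_def main_inv_def)
  have "S \<inter> {0..<m} = S" if "S \<in> C" for S
    using that by (auto simp: C_def partition_family_def)
  then have eq: "{S. S \<in> C \<and> S \<inter> {0..<m} = A} = (if A \<in> C then {A} else {})"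
    by auto
  \<comment> \<open>After all decisions at most the set \<open>A\<close> itself satisfies the
    condition, so positive mass forces \<open>A\<close> into the family.\<close>
  then have AC: "A \<in> C"
    using base.prems(3) by (auto simp: cond_mass_def split: if_splits)
  then have "cond_mass L C m A = pminor L A"
    using eq by (simp add: cond_mass_def)
  then have "cond_prob L C m A S = (if S = selected m s then 1 else 0)" if "S \<in> C" for S
    using that base.prems sel by (auto simp: cond_prob_def C_def partition_family_def)
  then show ?case
    unfolding loop_prog_def using base.prems AC sel
    by (intro samples_within_mono[OF samples_within_While_end])
      (auto simp: main_inv_def weights_loaded_def)
next
  case (step i)
  let ?z = "cond_mass L C (Suc i)"
  let ?\<beta> = "?z (insert i A) / cond_mass L C i A"
  let ?T = "(m - Suc i) * (2 * coeff_time m p + 110) + 4"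
  have c: "L \<in> carrier_mat m m" using L by (simp add: psd_def)
  have sub: "\<And>S. S \<in> C \<Longrightarrow> S \<subseteq> {0..<m}" by (auto simp: C_def partition_family_def)
  have sum: "cond_mass L C i A = ?z A + ?z (insert i A)"
    using step.prems by (intro cond_mass_split) (auto simp: C_def)
  have nonneg: "0 \<le> ?z A'" for A'
    by (rule cond_mass_nonneg[OF L sub])
  have A': "A \<subseteq> {0..<Suc i}" "insert i A \<subseteq> {0..<Suc i}"
    using step.prems by auto
  \<comment> \<open>The last two facts say that a branch reached with positive probability has
    positive mass, which re-establishes the hypothesis of the induction.\<close>
  have \<beta>: "0 \<le> ?\<beta>" "?\<beta> \<le> 1" "0 < ?\<beta> \<Longrightarrow> 0 < ?z (insert i A)" "?\<beta> < 1 \<Longrightarrow> 0 < ?z A"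
    using step.prems(3) nonneg[of A] nonneg[of "insert i A"] unfolding sum
    by (auto simp: field_simps zero_less_mult_iff)
  have rest: "samples_within
      (Seq (Toss ''S'' [NGet ''i'' []] (RDiv (RGet ''z1'' []) (RAdd (RGet ''z0'' []) (RGet ''z1'' []))))
        (Seq settle_prog loop_prog)) s' (selected m) C (cond_prob L C i A) (8 + (40 + ?T))"
    if post: "trial_post m p P b L i A s'" for s'
  proof -
    have bias: "rval s' (RDiv (RGet ''z1'' []) (RAdd (RGet ''z0'' []) (RGet ''z1'' []))) = ?\<beta>"
      and idx: "map (nval s') [NGet ''i'' []] = [i]"
      using post by (simp_all add: trial_post_def C_def[symmetric] sum)
    have settle: "samples_within (Seq settle_prog loop_prog) s'' (selected m) C
        (cond_prob L C (Suc i) A'') (40 + ?T)"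
      if "runs_to settle_prog (main_inv m p P b L (Suc i) A'') 40 s''" "A'' \<subseteq> {0..<Suc i}" "0 < ?z A''"
      for A'' s''
      by (rule samples_within_Seq[OF that(1)]) (use that step.IH in blast)
    have "samples_within
      (Seq (Toss ''S'' [NGet ''i'' []] (RDiv (RGet ''z1'' []) (RAdd (RGet ''z0'' []) (RGet ''z1'' []))))
        (Seq settle_prog loop_prog)) s' (selected m) C
        (\<lambda>S. ?\<beta> * cond_prob L C (Suc i) (insert i A) S + (1 - ?\<beta>) * cond_prob L C (Suc i) A S)
        (1 + sum_list (map ncost [NGet ''i'' []]) +
          rcost (RDiv (RGet ''z1'' []) (RAdd (RGet ''z0'' []) (RGet ''z1'' []))) + (40 + ?T))"
      using samples_within_Toss[where s = s' and x = "''S''" and js = "[NGet ''i'' []]"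
          and e = "RDiv (RGet ''z1'' []) (RAdd (RGet ''z0'' []) (RGet ''z1'' []))", unfolded bias idx,
          OF \<beta>(1,2) settle[OF runs_to_settle_prog(1)[OF pd step.hyps(2) step.prems(1) post] A'(2) \<beta>(3)]
          settle[OF runs_to_settle_prog(2)[OF pd step.hyps(2) step.prems(1) post] A'(1) \<beta>(4)]] .
    then show ?thesis
      by (rule samples_within_mono)
        (use cond_prob_step[OF L sub step.prems(1,3)] in auto)
  qed
  have "samples_within (Seq trial_prog
      (Seq (Toss ''S'' [NGet ''i'' []] (RDiv (RGet ''z1'' []) (RAdd (RGet ''z0'' []) (RGet ''z1'' []))))
        (Seq settle_prog loop_prog))) s (selected m) C (cond_prob L C i A)
      ((2 * coeff_time m p + 50) + (8 + (40 + ?T)))"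
    by (rule samples_within_Seq[OF runs_to_trial_prog[OF c pd step.hyps(2) step.prems(1,2)] rest])
  then have "samples_within (Seq round_prog loop_prog) s (selected m) C (cond_prob L C i A)
      ((2 * coeff_time m p + 50) + (8 + (40 + ?T)))"
    unfolding round_prog_def
    by (rule samples_within_Seq_assoc_inner)
  then have "samples_within loop_prog s (selected m) C (cond_prob L C i A)
      (1 + tcost (NLess (NGet ''i'' []) (NGet ''m'' [])) + ((2 * coeff_time m p + 50) + (8 + (40 + ?T))))"
    using step.prems(2) step.hyps(2) unfolding loop_prog_def
    by (intro samples_within_While_unfold) (auto simp: main_inv_def weights_loaded_def)
  moreover have "m - i = Suc (m - Suc i)" using step.hyps by simp
  ultimately show ?case
    by (elim samples_within_mono) auto
qed

section \<open>Polynomial time bounds for a fixed number of parts\<close>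

definition poly_function :: "(nat \<Rightarrow> nat) \<Rightarrow> bool" where
  "poly_function f \<longleftrightarrow> (\<exists>q. \<forall>m. poly q m = f m)"

text \<open>In the rule for powers the exponent is independent of \<open>m\<close>. This is where
  \<open>p\<close> has to be fixed, as the time bound contains
  \<open>(m + 1) ^ (p + 1)\<close>.\<close>

lemma poly_function_intros:
  "poly_function (\<lambda>m. m)" "poly_function (\<lambda>m. k)"
  "poly_function f \<Longrightarrow> poly_function g \<Longrightarrow> poly_function (\<lambda>m. f m + g m)"
  "poly_function f \<Longrightarrow> poly_function g \<Longrightarrow> poly_function (\<lambda>m. f m * g m)"
  "poly_function f \<Longrightarrow> poly_function (\<lambda>m. f m ^ k)"
proof -
  show "poly_function (\<lambda>m. m)"
    unfolding poly_function_def by (rule exI[of _ "[:0, 1:]"]) simp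
  show "poly_function (\<lambda>m. k)"
    unfolding poly_function_def by (rule exI[of _ "[:k:]"]) simp
  show "poly_function f \<Longrightarrow> poly_function g \<Longrightarrow> poly_function (\<lambda>m. f m + g m)"
    unfolding poly_function_def by (metis poly_add)
  show "poly_function f \<Longrightarrow> poly_function g \<Longrightarrow> poly_function (\<lambda>m. f m * g m)"
    unfolding poly_function_def by (metis poly_mult)
  show "poly_function f \<Longrightarrow> poly_function (\<lambda>m. f m ^ k)"
    unfolding poly_function_def by (metis poly_power)
qed

theorem corollary3p1:
  shows "\<exists>prog :: com. \<forall>p :: nat. \<exists>q :: nat poly.
    \<forall>(m :: nat) (L :: real mat) (P :: nat \<Rightarrow> nat set) (b :: nat \<Rightarrow> nat).
      psd m L \<longrightarrow> partition_data m p P b \<longrightarrow> 0 < dpp_mass L (partition_family m p P b) \<longrightarrow>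
      samples_within prog (input m L p P b) (selected m) (partition_family m p P b)
        (dpp_restricted L (partition_family m p P b)) (poly q m)"
\<comment> \<open>One program serves every \<open>p\<close>: the number of parts is read from the
  input, and only the polynomial depends on it.\<close>
proof (intro exI[of _ "Seq prepare_prog loop_prog"] allI)
  fix p :: nat
  have "poly_function (\<lambda>m. prepare_time m p + (m * (2 * coeff_time m p + 110) + 4))"
    unfolding prepare_time_def coeff_time_def step_time_def by (intro poly_function_intros)
  then obtain q where q: "\<And>m. poly q m = prepare_time m p + (m * (2 * coeff_time m p + 110) + 4)"
    unfolding poly_function_def by blast
  show "\<exists>q. \<forall>m L P b. psd m L \<longrightarrow> partition_data m p P b \<longrightarrow>
      0 < dpp_mass L (partition_family m p P b) \<longrightarrow>
      samples_within (Seq prepare_prog loop_prog) (input m L p P b) (selected m)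
        (partition_family m p P b) (dpp_restricted L (partition_family m p P b)) (poly q m)"
  proof (intro exI[of _ q] allI impI)
    fix m L P b
    let ?C = "partition_family m p P b"
    assume L: "psd m L" and pd: "partition_data m p P b" and pos: "0 < dpp_mass L ?C"
    have mass: "cond_mass L ?C 0 {} = dpp_mass L ?C"
      by (simp add: cond_mass_def dpp_mass_def)
    have "samples_within loop_prog s (selected m) ?C (cond_prob L ?C 0 {})
        (m * (2 * coeff_time m p + 110) + 4)" if "main_inv m p P b L 0 {} s" for s
      using samples_within_loop_prog[OF L pd, of 0 "{}" s] that pos mass by simp
    then have "samples_within (Seq prepare_prog loop_prog) (input m L p P b) (selected m) ?C
        (cond_prob L ?C 0 {}) (prepare_time m p + (m * (2 * coeff_time m p + 110) + 4))"
      by (rule samples_within_Seq[OF runs_to_prepare_prog[OF pd refl]])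
    then show "samples_within (Seq prepare_prog loop_prog) (input m L p P b) (selected m) ?C
        (dpp_restricted L ?C) (poly q m)"
      by (rule samples_within_mono) (simp_all add: q cond_prob_def dpp_restricted_def mass)
  qed
qed

end
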